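(* Under the assumptions listed in the context, there exists a sequence $(\phi_h^n,r_h^n)_{n\ge1}$ of $U_h\times\mathbb R$-valued random variables which solves the scheme described in the context for each $\omega\in\Omega$, such that the map $(\phi_h^n,r_h^n):\Omega\to U_h\times\mathbb R$ is $\mathcal F_{t^n}$-measurable.
   Context: Setting. $T>0$, $d\in\{2,3\}$, $\mathcal O\subset\mathbb R^d$ is a bounded convex polygonal (polyhedral) domain, and $(\Omega,\mathcal A,\mathcal F,\mathbb P)$ is a filtered probability space with $\mathcal F=(\mathcal F_t)_{t\in[0,T]}$. Time grid: $\tau=T/N<1$, $t^n=n\tau$, $n=0,\dots,N$. Space discretization: $\{\mathcal T_h\}_{h\in(0,1]}$ is a quasi-uniform family of partitions of $\mathcal O$ into disjoint open simplices $K$ with $\overline{\mathcal O}=\bigcup_{K}\overline K$ and $\max_K\operatorname{diam}K\le h$. $U_h$ is the space of continuous functions that are piecewise linear on $\mathcal T_h$; $\mathcal I_h:C^0(\overline{\mathcal O})\to U_h$ is nodal interpolation. Potential: $F\in C^2(\mathbb R)$ with $F\ge\gamma>0$, $c_\gamma(1+|\zeta|^4)\le F(\zeta)\le C(1+|\zeta|^4)$ with $c_\gamma>0$, $|F'(\zeta)|\le C(1+|\zeta|^3)$, $|F''(\zeta)|\le C(1+|\zeta|^2)$; and $F=F_1+F_2$ with $F_1\in C^{2,\nu}(\mathbb R)$ ($\nu\in(0,1]$), $F_2\in C^3(\mathbb R)$, $|F_2'''(\zeta)|\le C(1+|\zeta|^2)$. Initial data: deterministic $\phi_0\in H^1(\mathcal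 O)$ and mappings $\mathcal P_h:H^1(\mathcal O)\to U_h$ with $\|\mathcal P_h\phi_0\|_{H^1(\mathcal O)}\le C(\phi_0)$ uniformly in $h$ and $\mathcal P_h\phi_0\to\phi_0$ in $L^2(\mathcal O)$ as $h\searrow0$. Coefficient: $\sigma:\mathbb R\to\mathbb R$ is bounded and Lipschitz continuous. Noise: $(\mathfrak g_k)_{k\in\mathbb Z}$ is an orthonormal basis of $L^2(\mathcal O)$, $(\lambda_k)_{k\in\mathbb Z}$ real numbers with $\sum_k\lambda_k^2\|\mathfrak g_k\|_{W^{1,\infty}(\mathcal O)}^2\le\widetilde C<\infty$. Put $\mathcal F^\tau_t:=\mathcal F_{t^{n-1}}$ for $t\in[t^{n-1},t^n)$ and $\mathcal F^\tau_T:=\mathcal F_T$. The increments $\blacktriangle^n\boldsymbol\xi^\tau=\sqrt\tau\sum_{k\in\mathbb Z}\lambda_k\mathfrak g_k\xi_k^{n,\tau}$, $n=1,\dots,N$, are $\mathcal F^\tau_{t^n}$-measurable and independent of $\mathcal F^\tau_{t^m}$ for $0\le m\le n-1$, where $\xi_k^{n,\tau}$ are mutually independent symmetric random variables with mean $0$, variance $1$, and $\mathbb E[|\xi_k^{n,\tau}|^p]\le C_p$ for all integers $p\ge2$. $\mathbb Z_h\subset\mathbb Z$ is a finite set. For $\zeta_h\in U_h$, $\Phi_h(\zeta_h)f:=\sum_{k\in\mathbb Z_h}\mathcal I_h\{\sigma(\zeta_h)(f,\mathfrak g_k)_{L^2}\mathfrak g_k\}$, so $\Phi_h(\zeta_h)\blacktriangle^n\boldsymbol\xi^\tau=\sqrt\tau\sum_{k\in\mathbb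 Z_h}\lambda_k\xi_k^{n,\tau}\mathcal I_h\{\sigma(\zeta_h)\mathfrak g_k\}$. Scheme: $E_h(\zeta_h):=\int_{\mathcal O}\mathcal I_h\{F(\zeta_h)\}\,\mathrm dx$, $\phi_h^0:=\mathcal P_h\phi_0$, $r_h^0:=\sqrt{E_h(\phi_h^0)}$. For $n\ge1$ abbreviate $B^n:=\Phi_h(\phi_h^{n-1})\blacktriangle^n\boldsymbol\xi^\tau\in U_h$, $E:=E_h(\phi_h^{n-1})$, $A^n:=\int_{\mathcal O}\mathcal I_h\{F'(\phi_h^{n-1})B^n\}\,\mathrm dx$. Given $(\phi_h^{n-1},r_h^{n-1})$, find $(\phi_h^n,r_h^n)$ such that pathwise, for all $\psi_h\in U_h$, $$\int_{\mathcal O}\mathcal I_h\{(\phi_h^n-\phi_h^{n-1})\psi_h\}\,\mathrm dx+\tau\int_{\mathcal O}\nabla\phi_h^n\cdot\nabla\psi_h\,\mathrm dx+\tau r_h^n\Big(\tfrac1{\sqrt E}-\tfrac{A^n}{4E^{3/2}}\Big)\int_{\mathcal O}\mathcal I_h\{F'(\phi_h^{n-1})\psi_h\}\,\mathrm dx+\tfrac{\tau r_h^n}{2\sqrt E}\int_{\mathcal O}\mathcal I_h\{F''(\phi_h^{n-1})B^n\psi_h\}\,\mathrm dx=\int_{\mathcal O}\mathcal I_h\{B^n\psi_h\}\,\mathrm dx$$ and $$r_h^n-r_h^{n-1}=\Big(\tfrac{1}{2\sqrt E}-\tfrac{A^n}{8E^{3/2}}\Big)\int_{\mathcal O}\mathcal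 I_h\{F'(\phi_h^{n-1})(\phi_h^n-\phi_h^{n-1})\}\,\mathrm dx+\tfrac1{4\sqrt E}\int_{\mathcal O}\mathcal I_h\{F''(\phi_h^{n-1})(\phi_h^n-\phi_h^{n-1})B^n\}\,\mathrm dx.$$ *)

theory Defs
  imports "HOL-Probability.Probability"
begin

section \<open>Function spaces on a domain\<close>

text \<open>Elements of $L^2(D)$, $H^1(D)$ and $W^{1,\infty}(D)$ are represented by functions on the
  whole space of which only the restriction to \<open>D\<close>, up to null sets, matters.\<close>

definition L2_inner :: "(real^'d) set \<Rightarrow> (real^'d \<Rightarrow> real) \<Rightarrow> (real^'d \<Rightarrow> real) \<Rightarrow> real" where
  "L2_inner D f g = (\<integral>x. f x * g x \<partial>lebesgue_on D)"

definition L2_norm :: "(real^'d) set \<Rightarrow> (real^'d \<Rightarrow> real) \<Rightarrow> real" where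
  "L2_norm D f = sqrt (L2_inner D f f)"

definition L2_space :: "(real^'d) set \<Rightarrow> (real^'d \<Rightarrow> real) set" where
  "L2_space D = {f \<in> borel_measurable (lebesgue_on D). integrable (lebesgue_on D) (\<lambda>x. (f x)\<^sup>2)}"

text \<open>The Borel sigma-algebra, with respect to the (semi)norm of $L^2(D)$, of a set \<open>V\<close> of
  square-integrable functions. It is used for $L^2(D)$ itself and for finite-dimensional spaces
  of continuous functions, where the choice of the norm is immaterial.\<close>

definition L2_borel :: "(real^'d) set \<Rightarrow> (real^'d \<Rightarrow> real) set \<Rightarrow> (real^'d \<Rightarrow> real) measure" where
  "L2_borel D V = sigma V
     {A. A \<subseteq> V \<and> (\<forall>u\<in>A. \<exists>e>0. \<forall>v\<in>V. L2_norm D (\<lambda>x. v x - u x) < e \<longrightarrow> v \<in> A)}"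

definition orthonormal_basis_L2 :: "(real^'d) set \<Rightarrow> (int \<Rightarrow> real^'d \<Rightarrow> real) \<Rightarrow> bool" where
  "orthonormal_basis_L2 D g \<longleftrightarrow>
     (\<forall>k. g k \<in> L2_space D) \<and>
     (\<forall>j k. L2_inner D (g j) (g k) = (if j = k then 1 else 0)) \<and>
     (\<forall>f\<in>L2_space D.
        ((\<lambda>J. L2_norm D (\<lambda>x. f x - (\<Sum>k\<in>J. L2_inner D f (g k) * g k x))) \<longlongrightarrow> 0)
          (finite_subsets_at_top UNIV))"

definition grad :: "(real^'d \<Rightarrow> real) \<Rightarrow> real^'d \<Rightarrow> real^'d" where
  "grad u x = (\<chi> i. frechet_derivative u (at x) (axis i 1))"

text \<open>$C^\infty$: \<open>E is\<close> is the iterated partial derivative of \<open>f\<close> along the list \<open>is\<close> of directions.\<close>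

definition smooth :: "(real^'d \<Rightarrow> real) \<Rightarrow> bool" where
  "smooth f \<longleftrightarrow> (\<exists>E :: 'd list \<Rightarrow> real^'d \<Rightarrow> real. E [] = f \<and>
     (\<forall>is x. (E is has_derivative (\<lambda>v. \<Sum>i\<in>UNIV. E (i # is) x * v $ i)) (at x)))"

definition test_functions :: "(real^'d) set \<Rightarrow> (real^'d \<Rightarrow> real) set" where
  "test_functions D = {\<psi>. smooth \<psi> \<and> compact (closure {x. \<psi> x \<noteq> 0}) \<and> closure {x. \<psi> x \<noteq> 0} \<subseteq> D}"

definition locally_integrable ::
    "(real^'d) set \<Rightarrow> (real^'d \<Rightarrow> 'b::{banach, second_countable_topology}) \<Rightarrow> bool" where
  "locally_integrable D u \<longleftrightarrow> (\<forall>K. compact K \<and> K \<subseteq> D \<longrightarrow> integrable (lebesgue_on K) u)"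

definition has_weak_gradient ::
    "(real^'d) set \<Rightarrow> (real^'d \<Rightarrow> real) \<Rightarrow> (real^'d \<Rightarrow> real^'d) \<Rightarrow> bool" where
  "has_weak_gradient D u G \<longleftrightarrow> locally_integrable D u \<and> locally_integrable D G \<and>
     (\<forall>\<psi>\<in>test_functions D. \<forall>i.
        (\<integral>x. u x * grad \<psi> x $ i \<partial>lebesgue_on D) = - (\<integral>x. G x $ i * \<psi> x \<partial>lebesgue_on D))"

text \<open>Weak gradients are unique only up to null sets.\<close>

definition weak_grad :: "(real^'d) set \<Rightarrow> (real^'d \<Rightarrow> real) \<Rightarrow> real^'d \<Rightarrow> real^'d" where
  "weak_grad D u = (SOME G. has_weak_gradient D u G)"

definition H1_space :: "(real^'d) set \<Rightarrow> (real^'d \<Rightarrow> real) set" where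
  "H1_space D = {u \<in> L2_space D. (\<exists>G. has_weak_gradient D u G) \<and>
     (\<forall>i. (\<lambda>x. weak_grad D u x $ i) \<in> L2_space D)}"

definition H1_norm :: "(real^'d) set \<Rightarrow> (real^'d \<Rightarrow> real) \<Rightarrow> real" where
  "H1_norm D u = sqrt ((L2_norm D u)\<^sup>2 + (\<Sum>i\<in>UNIV. (L2_norm D (\<lambda>x. weak_grad D u x $ i))\<^sup>2))"

definition W1inf_norm :: "(real^'d) set \<Rightarrow> (real^'d \<Rightarrow> real) \<Rightarrow> ereal" where
  "W1inf_norm D u = esssup (lebesgue_on D) (\<lambda>x. ereal \<bar>u x\<bar>) +
     esssup (lebesgue_on D) (\<lambda>x. ereal (norm (weak_grad D u x)))"

definition W1inf_space :: "(real^'d) set \<Rightarrow> (real^'d \<Rightarrow> real) set" where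
  "W1inf_space D = {u. (\<exists>G. has_weak_gradient D u G) \<and> W1inf_norm D u < \<infinity>}"

definition C_k :: "nat \<Rightarrow> (real \<Rightarrow> real) \<Rightarrow> bool" where
  "C_k k f \<longleftrightarrow> (\<forall>j<k. \<forall>x. (deriv ^^ j) f field_differentiable (at x)) \<and>
     continuous_on UNIV ((deriv ^^ k) f)"

text \<open>Only the highest derivative is controlled globally: the lower-order ones may grow.\<close>

definition C_k_Hoelder :: "nat \<Rightarrow> real \<Rightarrow> (real \<Rightarrow> real) \<Rightarrow> bool" where
  "C_k_Hoelder k \<nu> f \<longleftrightarrow> C_k k f \<and>
     (\<exists>L. \<forall>x y. \<bar>(deriv ^^ k) f x - (deriv ^^ k) f y\<bar> \<le> L * \<bar>x - y\<bar> powr \<nu>)"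


section \<open>Simplicial meshes and linear finite elements\<close>

definition polyhedral_domain :: "(real^'d) set \<Rightarrow> bool" where
  "polyhedral_domain D \<longleftrightarrow> open D \<and> D \<noteq> {} \<and> bounded D \<and> convex D \<and> polytope (closure D)"

text \<open>The elements are open. The last conjunct (the intersection of two closed elements is a common
  face) excludes hanging nodes; otherwise nodal interpolation would not be well defined.\<close>

definition simplicial_partition :: "(real^'d) set \<Rightarrow> (real^'d) set set \<Rightarrow> bool" where
  "simplicial_partition D \<T> \<longleftrightarrow> finite \<T> \<and>
     (\<forall>K\<in>\<T>. \<exists>S. int CARD('d) simplex S \<and> K = interior S) \<and>
     disjoint \<T> \<and> closure D = (\<Union>K\<in>\<T>. closure K) \<and>
     triangulation (closure ` \<T>)"

text \<open>Quasi-uniformity: every element of the mesh of size \<open>h\<close> has diameter at most \<open>h\<close> and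
  contains a ball of radius at least \<open>\<rho> h\<close>, where \<open>\<rho>\<close> does not depend on \<open>h\<close>.\<close>

definition quasi_uniform_family :: "(real^'d) set \<Rightarrow> (real \<Rightarrow> (real^'d) set set) \<Rightarrow> bool" where
  "quasi_uniform_family D \<T> \<longleftrightarrow>
     (\<forall>h\<in>{0<..1}. simplicial_partition D (\<T> h) \<and> (\<forall>K\<in>\<T> h. diameter K \<le> h)) \<and>
     (\<exists>\<rho>>0. \<forall>h\<in>{0<..1}. \<forall>K\<in>\<T> h. \<exists>x. ball x (\<rho> * h) \<subseteq> K)"

text \<open>Functions on \<open>closure D\<close> are extended by zero, so that they are determined by their values
  on \<open>closure D\<close>.\<close>

definition fe_space :: "(real^'d) set \<Rightarrow> (real^'d) set set \<Rightarrow> (real^'d \<Rightarrow> real) set" where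
  "fe_space D \<T> = {u. continuous_on (closure D) u \<and>
     (\<forall>K\<in>\<T>. \<exists>a b. \<forall>x\<in>K. u x = a \<bullet> x + b) \<and> (\<forall>x. x \<notin> closure D \<longrightarrow> u x = 0)}"

definition nodes :: "(real^'d) set set \<Rightarrow> (real^'d) set" where
  "nodes \<T> = (\<Union>K\<in>\<T>. {x. x extreme_point_of closure K})"

definition nodal_interp ::
    "(real^'d) set \<Rightarrow> (real^'d) set set \<Rightarrow> (real^'d \<Rightarrow> real) \<Rightarrow> real^'d \<Rightarrow> real" where
  "nodal_interp D \<T> f = (THE v. v \<in> fe_space D \<T> \<and> (\<forall>x\<in>nodes \<T>. v x = f x))"

definition interp_integral ::
    "(real^'d) set \<Rightarrow> (real^'d) set set \<Rightarrow> (real^'d \<Rightarrow> real) \<Rightarrow> real" where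
  "interp_integral D \<T> f = (\<integral>x. nodal_interp D \<T> f x \<partial>lebesgue_on D)"


section \<open>The discrete scheme\<close>

definition discrete_energy ::
    "(real^'d) set \<Rightarrow> (real^'d) set set \<Rightarrow> (real \<Rightarrow> real) \<Rightarrow> (real^'d \<Rightarrow> real) \<Rightarrow> real" where
  "discrete_energy D \<T> F \<zeta> = interp_integral D \<T> (\<lambda>x. F (\<zeta> x))"

definition discrete_noise_op ::
    "(real^'d) set \<Rightarrow> (real^'d) set set \<Rightarrow> (real \<Rightarrow> real) \<Rightarrow> (int \<Rightarrow> real^'d \<Rightarrow> real) \<Rightarrow> int set \<Rightarrow>
     (real^'d \<Rightarrow> real) \<Rightarrow> (real^'d \<Rightarrow> real) \<Rightarrow> real^'d \<Rightarrow> real" where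
  "discrete_noise_op D \<T> \<sigma> g Z \<zeta> f =
     (\<lambda>x. \<Sum>k\<in>Z. nodal_interp D \<T> (\<lambda>y. \<sigma> (\<zeta> y) * L2_inner D f (g k) * g k y) x)"

text \<open>One step of the scheme, from \<open>(\<phi>0, r0)\<close> to \<open>(\<phi>, r)\<close> with stochastic increment \<open>B\<close>. The
  gradient of a finite element function is the classical one, which exists off the null set
  formed by the boundaries of the elements.\<close>

definition scheme_step ::
    "(real^'d) set \<Rightarrow> (real^'d) set set \<Rightarrow> (real \<Rightarrow> real) \<Rightarrow> real \<Rightarrow> (real^'d \<Rightarrow> real) \<Rightarrow>
     (real^'d \<Rightarrow> real) \<Rightarrow> real \<Rightarrow> (real^'d \<Rightarrow> real) \<Rightarrow> real \<Rightarrow> bool" where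
  "scheme_step D \<T> F \<tau> B \<phi>0 r0 \<phi> r \<longleftrightarrow>
    (let E = discrete_energy D \<T> F \<phi>0;
         A = interp_integral D \<T> (\<lambda>x. deriv F (\<phi>0 x) * B x)
     in
      (\<forall>\<psi>\<in>fe_space D \<T>.
         interp_integral D \<T> (\<lambda>x. (\<phi> x - \<phi>0 x) * \<psi> x)
         + \<tau> * (\<integral>x. grad \<phi> x \<bullet> grad \<psi> x \<partial>lebesgue_on D)
         + \<tau> * r * (1 / sqrt E - A / (4 * E powr (3/2)))
             * interp_integral D \<T> (\<lambda>x. deriv F (\<phi>0 x) * \<psi> x)
         + \<tau> * r / (2 * sqrt E)
             * interp_integral D \<T> (\<lambda>x. deriv (deriv F) (\<phi>0 x) * B x * \<psi> x)
         = interp_integral D \<T> (\<lambda>x. B x * \<psi> x)) \<and>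
      r - r0 =
         (1 / (2 * sqrt E) - A / (8 * E powr (3/2)))
           * interp_integral D \<T> (\<lambda>x. deriv F (\<phi>0 x) * (\<phi> x - \<phi>0 x))
         + 1 / (4 * sqrt E)
           * interp_integral D \<T> (\<lambda>x. deriv (deriv F) (\<phi>0 x) * (\<phi> x - \<phi>0 x) * B x))"


section \<open>Filtration and noise\<close>

definition filtration_upto :: "'w measure \<Rightarrow> real \<Rightarrow> (real \<Rightarrow> 'w measure) \<Rightarrow> bool" where
  "filtration_upto M T \<F> \<longleftrightarrow> (\<forall>t\<in>{0..T}. subalgebra M (\<F> t)) \<and>
     (\<forall>s\<in>{0..T}. \<forall>t\<in>{0..T}. s \<le> t \<longrightarrow> sets (\<F> s) \<subseteq> sets (\<F> t))"

text \<open>The piecewise constant filtration: the time is rounded down to a multiple of \<open>\<tau>\<close>.\<close>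

definition discrete_filtration :: "real \<Rightarrow> (real \<Rightarrow> 'w measure) \<Rightarrow> real \<Rightarrow> 'w measure" where
  "discrete_filtration \<tau> \<F> t = \<F> (of_int \<lfloor>t / \<tau>\<rfloor> * \<tau>)"

lemma discrete_filtration_eq:
  assumes "\<tau> > 0" "n \<ge> 1" "t \<in> {real (n - 1) * \<tau>..<real n * \<tau>}"
  shows "discrete_filtration \<tau> \<F> t = \<F> (real (n - 1) * \<tau>)"
proof -
  have "\<lfloor>t / \<tau>\<rfloor> = int (n - 1)"
    using assms by (intro floor_unique) (auto simp: field_simps of_nat_diff)
  then show ?thesis by (simp add: discrete_filtration_def)
qed

lemma discrete_filtration_final:
  assumes "T > 0" "N > 0" "\<tau> = T / real N"
  shows "discrete_filtration \<tau> \<F> T = \<F> T"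
  using assms by (simp add: discrete_filtration_def)

definition noise_coefficients ::
    "'w measure \<Rightarrow> nat \<Rightarrow> (nat \<Rightarrow> int \<Rightarrow> 'w \<Rightarrow> real) \<Rightarrow> bool" where
  "noise_coefficients M N \<xi> \<longleftrightarrow>
     prob_space.indep_vars M (\<lambda>_. borel) (\<lambda>(n, k). \<xi> n k) ({1..N} \<times> UNIV) \<and>
     (\<forall>n\<in>{1..N}. \<forall>k.
        distr M borel (\<lambda>\<omega>. - \<xi> n k \<omega>) = distr M borel (\<xi> n k) \<and>
        integrable M (\<xi> n k) \<and> prob_space.expectation M (\<xi> n k) = 0 \<and>
        prob_space.variance M (\<xi> n k) = 1) \<and>
     (\<forall>p\<ge>2. \<exists>C. \<forall>n\<in>{1..N}. \<forall>k.
        integrable M (\<lambda>\<omega>. \<bar>\<xi> n k \<omega>\<bar> ^ p) \<and>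
        prob_space.expectation M (\<lambda>\<omega>. \<bar>\<xi> n k \<omega>\<bar> ^ p) \<le> C)"

text \<open>\<open>W n\<close> is the \<open>n\<close>-th increment, an $L^2(D)$-valued random variable. The series converges in
  $L^2(D)$ for almost every \<open>\<omega>\<close> only, so \<open>W n\<close> is a version of its sum.\<close>

definition noise_increments ::
    "'w measure \<Rightarrow> (real \<Rightarrow> 'w measure) \<Rightarrow> nat \<Rightarrow> real \<Rightarrow> (real^'d) set \<Rightarrow> (int \<Rightarrow> real) \<Rightarrow>
     (int \<Rightarrow> real^'d \<Rightarrow> real) \<Rightarrow> (nat \<Rightarrow> int \<Rightarrow> 'w \<Rightarrow> real) \<Rightarrow> (nat \<Rightarrow> 'w \<Rightarrow> real^'d \<Rightarrow> real) \<Rightarrow> bool" where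
  "noise_increments M \<F> N \<tau> D lam g \<xi> W \<longleftrightarrow>
     (\<forall>n\<in>{1..N}.
        (AE \<omega> in M.
          ((\<lambda>J. L2_norm D (\<lambda>x. W n \<omega> x - sqrt \<tau> * (\<Sum>k\<in>J. lam k * g k x * \<xi> n k \<omega>))) \<longlongrightarrow> 0)
            (finite_subsets_at_top UNIV)) \<and>
        W n \<in> measurable (discrete_filtration \<tau> \<F> (real n * \<tau>)) (L2_borel D (L2_space D)) \<and>
        (\<forall>m<n. prob_space.indep_set M
          (sets (vimage_algebra (space M) (W n) (L2_borel D (L2_space D))))
          (sets (discrete_filtration \<tau> \<F> (real m * \<tau>)))))"

end

theory Submission
  imports Defs
begin

text \<open>Every term of one step, except the gradient term, is an integral of a nodal interpolant, so it is a
  weighted sum of nodal values. The weights are the integrals of the hat functions, and they are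
  positive (\<open>mass_pos\<close>). The gradient term is a symmetric positive semidefinite bilinear form in the
  nodal values (\<open>stiffness_expansion\<close>, \<open>stiffness_nonneg\<close>). One step is therefore a finite system
  of equations for the nodal values of \<open>\<phi>\<close> and for \<open>r\<close>.

  This system is linear, since the nonlinear terms are evaluated at the old function \<open>\<phi>0\<close>. The point
  is that one and the same linear functional
  \<open>L \<psi> = (1 / sqrt E - A / (4 * E powr (3/2))) \<integral>I(F'(\<phi>0) \<psi>) + 1 / (2 * sqrt E) \<integral>I(F''(\<phi>0) B \<psi>)\<close>
  occurs in both equations. With \<open>S\<close> for the form \<open>(\<phi>, \<psi>)\<^sub>h + \<tau> (\<nabla>\<phi>, \<nabla>\<psi>)\<close>, where
  \<open>(\<phi>, \<psi>)\<^sub>h = \<integral>I(\<phi> \<psi>)\<close>, they read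

      \<open>S \<phi> \<psi> + \<tau> r L \<psi> = (B + \<phi>0, \<psi>)\<^sub>h\<close> for all \<open>\<psi>\<close>,  and  \<open>r - r0 = L (\<phi> - \<phi>0) / 2\<close>.

  The form \<open>S\<close> is deterministic and positive definite. Let \<open>R\<close> be the linear map that represents
  functionals with respect to \<open>S\<close>. The first equation gives \<open>\<phi> = R b - \<tau> r R L\<close>, with
  \<open>b = (B + \<phi>0, \<cdot>)\<^sub>h\<close>, and inserting this into the second equation leaves

      \<open>(1 + \<tau> L (R L) / 2) r = r0 - L \<phi>0 / 2 + L (R b) / 2\<close>.

  Since \<open>L (R L) = S (R L) (R L) \<ge> 0\<close>, the factor on the left is at least 1. So the step has a
  solution given by an explicit formula (the Sherman--Morrison formula, as eliminating \<open>r\<close> perturbs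
  \<open>S\<close> by the rank one form \<open>\<tau>/2 L \<otimes> L\<close>). The formula involves only arithmetic operations, square
  roots and powers, the continuous functions \<open>F\<close>, \<open>F'\<close>, \<open>F''\<close>, and the nodal values of the data,
  and therefore depends measurably on the data: this is \<open>scheme_step_measurable_solution\<close>.

  Adaptedness follows by induction on the time step. The nodal values of the noise term are finite
  sums of products of \<open>\<sigma>(\<phi>0)\<close>, the constants \<open>g k x\<close> and the \<open>L\<^sup>2\<close> inner products of the increment
  with \<open>g k\<close>; the last depend continuously on the increment (\<open>L2_inner_measurable\<close>). Conversely,
  measurable nodal values make a measurable map into the finite element space, because the
  coefficient map is continuous (\<open>measurable_into_L2_borel\<close>).\<close>

section \<open>Affine functions on simplices\<close>

text \<open>After a translation that moves one point of \<open>C\<close> to the origin, the others become linearly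
  independent, so that a linear functional may be prescribed on them.\<close>
lemma affine_function_with_prescribed_values:
  fixes C :: "'a::euclidean_space set" and f :: "'a \<Rightarrow> real"
  assumes "\<not> affine_dependent C"
  obtains a b where "\<And>x. x \<in> C \<Longrightarrow> a \<bullet> x + b = f x"
proof (cases "C = {}")
  case True
  then show ?thesis using that by auto
next
  case False
  then obtain p where p: "p \<in> C" by auto
  let ?B = "(\<lambda>x. - p + x) ` (C - {p})"
  have "independent ?B"
    using assms affine_dependent_iff_dependent2[OF p] by blast
  then obtain g :: "'a \<Rightarrow> real"
    where g: "linear g" "\<And>y. y \<in> ?B \<Longrightarrow> g y = f (p + y) - f p"
    using linear_independent_extend[of ?B "\<lambda>y. f (p + y) - f p"] by blast
  have rep: "g y = adjoint g 1 \<bullet> y" for y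
    using adjoint_works[OF g(1), of y 1] by (simp add: inner_commute)
  show ?thesis
  proof
    fix x assume x: "x \<in> C"
    have "g (x - p) = f x - f p"
    proof (cases "x = p")
      case True
      then show ?thesis using g(1) by (simp add: linear_0)
    next
      case False
      then have "- p + x \<in> ?B" using x by blast
      from g(2)[OF this] show ?thesis by (simp add: add.commute)
    qed
    then show "adjoint g 1 \<bullet> x + (f p - adjoint g 1 \<bullet> p) = f x"
      using rep[of "x - p"] by (simp add: inner_diff_right)
  qed
qed

lemma affine_eq_on_convex_hull:
  fixes a a' :: "'a::euclidean_space"
  assumes "\<And>x. x \<in> C \<Longrightarrow> a \<bullet> x + b = a' \<bullet> x + b'" "x \<in> convex hull C"
  shows "a \<bullet> x + b = a' \<bullet> x + b'"
proof -
  have "convex {x. (a - a') \<bullet> x = b' - b}" by (rule convex_hyperplane)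
  moreover have "C \<subseteq> {x. (a - a') \<bullet> x = b' - b}"
    using assms(1) by (fastforce simp: inner_diff_left)
  ultimately have "convex hull C \<subseteq> {x. (a - a') \<bullet> x = b' - b}"
    by (rule hull_minimal[rotated])
  then have "x \<in> {x. (a - a') \<bullet> x = b' - b}" using assms(2) by blast
  then show ?thesis by (simp add: inner_diff_left algebra_simps)
qed

lemma affine_in_Icc_on_convex_hull:
  fixes a :: "'a::euclidean_space"
  assumes "\<And>x. x \<in> C \<Longrightarrow> a \<bullet> x + b \<in> {l..u}" "x \<in> convex hull C"
  shows "a \<bullet> x + b \<in> {l..u}"
proof -
  have "convex ({x. a \<bullet> x \<ge> l - b} \<inter> {x. a \<bullet> x \<le> u - b})"
    by (intro convex_Int convex_halfspace_ge convex_halfspace_le)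
  moreover have "C \<subseteq> {x. a \<bullet> x \<ge> l - b} \<inter> {x. a \<bullet> x \<le> u - b}"
    using assms(1) by fastforce
  ultimately have "convex hull C \<subseteq> {x. a \<bullet> x \<ge> l - b} \<inter> {x. a \<bullet> x \<le> u - b}"
    by (rule hull_minimal[rotated])
  then show ?thesis using assms(2) by auto
qed

lemma grad_affine:
  fixes u :: "real^'d \<Rightarrow> real"
  assumes "open K" "x \<in> K" "\<And>y. y \<in> K \<Longrightarrow> u y = a \<bullet> y + b"
  shows "grad u x = a"
proof -
  have "((\<lambda>y. a \<bullet> y + b) has_derivative (\<lambda>v. a \<bullet> v)) (at x)"
    by (auto intro!: derivative_eq_intros)
  then have "(u has_derivative (\<lambda>v. a \<bullet> v)) (at x)"
    by (rule has_derivative_transform_within_open[OF _ assms(1,2)]) (simp add: assms(3))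
  then have "frechet_derivative u (at x) = (\<lambda>v. a \<bullet> v)"
    by (rule frechet_derivative_at[symmetric])
  then show ?thesis
    by (simp add: grad_def vec_eq_iff inner_axis)
qed

section \<open>Positive definite linear systems\<close>

text \<open>The induction on \<open>I\<close> is Gram--Schmidt orthogonalisation. By the induction hypothesis the new basis
  vector \<open>z\<close> can be corrected by a vector \<open>p\<close> supported on \<open>I\<close> so that \<open>w = z + p\<close> is orthogonal to
  all old basis vectors. Adding a multiple of \<open>w\<close> to the solution of the old system
  adjusts the new equation and leaves the old ones untouched; the required division is by the value
  \<open>d > 0\<close> of the quadratic form at \<open>w\<close>.\<close>
lemma pos_def_system_solvable:
  fixes S :: "'i \<Rightarrow> 'i \<Rightarrow> real"
  assumes "finite I" and sym: "\<And>i j. i \<in> I \<Longrightarrow> j \<in> I \<Longrightarrow> S i j = S j i"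
    and pos: "\<And>c. \<exists>i\<in>I. c i \<noteq> 0 \<Longrightarrow> (\<Sum>i\<in>I. \<Sum>j\<in>I. S i j * c i * c j) > 0"
  shows "\<exists>c. \<forall>i\<in>I. (\<Sum>j\<in>I. S i j * c j) = b i"
  using assms
proof (induction I arbitrary: b rule: finite_induct)
  case empty
  then show ?case by simp
next
  case (insert z I)
  have ext: "(\<Sum>j\<in>insert z I. f j * (c(z := t)) j) = f z * t + (\<Sum>j\<in>I. f j * c j)"
    for f c :: "'i \<Rightarrow> real" and t
  proof -
    have "(\<Sum>j\<in>I. f j * (c(z := t)) j) = (\<Sum>j\<in>I. f j * c j)"
      using insert.hyps(2) by (intro sum.cong) auto
    then show ?thesis using insert.hyps by simp
  qed
  have posI: "(\<Sum>i\<in>I. \<Sum>j\<in>I. S i j * c i * c j) > 0" if "\<exists>i\<in>I. c i \<noteq> 0" for c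
  proof -
    let ?c = "c(z := 0)"
    have "\<exists>i\<in>insert z I. ?c i \<noteq> 0" using that insert.hyps(2) by auto
    from insert.prems(2)[OF this] show ?thesis
      using insert.hyps by (simp add: sum.insert cong: if_cong)
        (smt (verit, best) sum.cong)
  qed
  have IH: "\<exists>c. \<forall>i\<in>I. (\<Sum>j\<in>I. S i j * c j) = b i" for b
    by (rule insert.IH) (use insert.prems(1) posI in auto)
  obtain p where p: "\<And>i. i \<in> I \<Longrightarrow> (\<Sum>j\<in>I. S i j * p j) = - S i z" using IH[of "\<lambda>i. - S i z"] by auto
  obtain c0 where c0: "\<And>i. i \<in> I \<Longrightarrow> (\<Sum>j\<in>I. S i j * c0 j) = b i" using IH by blast
  define w where "w = p(z := 1)"
  define d where "d = (\<Sum>j\<in>insert z I. S z j * w j)"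
  have w_orth: "(\<Sum>j\<in>insert z I. S i j * w j) = 0" if "i \<in> I" for i
    unfolding w_def ext using p[OF that] by simp
  have "(\<Sum>i\<in>insert z I. \<Sum>j\<in>insert z I. S i j * w i * w j)
      = (\<Sum>i\<in>insert z I. w i * (\<Sum>j\<in>insert z I. S i j * w j))"
    by (simp add: sum_distrib_left mult_ac)
  also have "\<dots> = d"
    using insert.hyps w_orth by (simp add: d_def w_def)
  finally have "d > 0"
    using insert.prems(2)[of w] by (auto simp: w_def)
  define u where "u = c0(z := 0)"
  define t where "t = (b z - (\<Sum>j\<in>insert z I. S z j * u j)) / d"
  have lin: "(\<Sum>j\<in>insert z I. S i j * (u j + t * w j))
      = (\<Sum>j\<in>insert z I. S i j * u j) + t * (\<Sum>j\<in>insert z I. S i j * w j)" for i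
    by (simp only: distrib_left sum.distrib sum_distrib_left mult.left_commute)
  have "(\<Sum>j\<in>insert z I. S i j * (u j + t * w j)) = b i" if "i \<in> insert z I" for i
  proof (cases "i = z")
    case True
    then show ?thesis using \<open>d > 0\<close> unfolding lin by (simp add: d_def[symmetric] t_def)
  next
    case False
    then have i: "i \<in> I" using that by simp
    have "(\<Sum>j\<in>insert z I. S i j * u j) = b i" unfolding u_def ext using c0[OF i] by simp
    then show ?thesis unfolding lin using w_orth[OF i] by simp
  qed
  then show ?case by (intro exI[of _ "\<lambda>j. u j + t * w j"] ballI)
qed

section \<open>Measurability of the inner product on square-integrable functions\<close>

lemma L2_product_integrable:
  assumes "f \<in> L2_space D" "g \<in> L2_space D"
  shows "integrable (lebesgue_on D) (\<lambda>x. f x * g x)"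
proof (rule Bochner_Integration.integrable_bound)
  show "integrable (lebesgue_on D) (\<lambda>x. (f x)\<^sup>2 + (g x)\<^sup>2)"
    using assms by (auto simp: L2_space_def)
  show "(\<lambda>x. f x * g x) \<in> borel_measurable (lebesgue_on D)"
    using assms by (auto simp: L2_space_def)
  have "\<bar>a * b\<bar> \<le> a\<^sup>2 + b\<^sup>2" for a b :: real
  proof -
    have "2 * \<bar>a * b\<bar> \<le> a\<^sup>2 + b\<^sup>2"
      using sum_squares_bound[of "\<bar>a\<bar>" "\<bar>b\<bar>"] by (simp add: abs_mult mult.assoc)
    then show ?thesis by linarith
  qed
  then show "AE x in lebesgue_on D. norm (f x * g x) \<le> norm ((f x)\<^sup>2 + (g x)\<^sup>2)"
    by (simp add: sum_power2_ge_zero)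
qed

lemma L2_space_diff:
  assumes "f \<in> L2_space D" "g \<in> L2_space D"
  shows "(\<lambda>x. f x - g x) \<in> L2_space D"
proof -
  have "integrable (lebesgue_on D) (\<lambda>x. (f x)\<^sup>2 + (g x)\<^sup>2 - 2 * (f x * g x))"
    using assms L2_product_integrable[OF assms] by (auto simp: L2_space_def)
  then have "integrable (lebesgue_on D) (\<lambda>x. (f x - g x)\<^sup>2)"
    by (simp add: power2_diff mult.assoc)
  then show ?thesis using assms by (auto simp: L2_space_def)
qed

text \<open>The discriminant argument: the polynomial \<open>t \<mapsto> \<parallel>f - t g\<parallel>\<^sup>2\<close> is nonnegative.\<close>
lemma L2_Cauchy_Schwarz:
  assumes "f \<in> L2_space D" "g \<in> L2_space D"
  shows "\<bar>L2_inner D f g\<bar> \<le> L2_norm D f * L2_norm D g"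
proof -
  define a b c where "a = L2_inner D f f" and "b = L2_inner D f g" and "c = L2_inner D g g"
  have nn: "a \<ge> 0" "c \<ge> 0" by (simp_all add: a_def c_def L2_inner_def)
  have quad: "0 \<le> a - 2 * t * b + t\<^sup>2 * c" for t
  proof -
    have "0 \<le> (\<integral>x. (f x - t * g x) * (f x - t * g x) \<partial>lebesgue_on D)" by simp
    also have "\<dots> = (\<integral>x. f x * f x - 2 * t * (f x * g x) + t\<^sup>2 * (g x * g x) \<partial>lebesgue_on D)"
      by (simp add: algebra_simps power2_eq_square)
    also have "\<dots> = a - 2 * t * b + t\<^sup>2 * c"
      using L2_product_integrable[OF assms] L2_product_integrable[OF assms(1,1)]
        L2_product_integrable[OF assms(2,2)]
      by (simp add: a_def b_def c_def L2_inner_def)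
    finally show ?thesis .
  qed
  have "b\<^sup>2 \<le> a * c"
  proof (cases "c = 0")
    case True
    have "b = 0"
    proof (rule ccontr)
      assume "b \<noteq> 0"
      then show False using quad[of "(a + 1) / (2 * b)"] True by simp
    qed
    then show ?thesis using True by simp
  next
    case False
    then show ?thesis using quad[of "b / c"] nn by (simp add: field_simps power2_eq_square)
  qed
  then have "\<bar>b\<bar> \<le> sqrt (a * c)" by (rule real_le_rsqrt[of "\<bar>b\<bar>", simplified])
  then show ?thesis by (simp add: L2_norm_def a_def b_def c_def real_sqrt_mult)
qed

lemma space_L2_borel: "space (L2_borel D V) = V"
  unfolding L2_borel_def by (rule space_measure_of) auto

lemma L2_borel_open:
  assumes "A \<subseteq> V" "\<And>u. u \<in> A \<Longrightarrow> \<exists>e>0. \<forall>v\<in>V. L2_norm D (\<lambda>x. v x - u x) < e \<longrightarrow> v \<in> A"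
  shows "A \<in> sets (L2_borel D V)"
  unfolding L2_borel_def using assms by (subst sets_measure_of) auto

text \<open>By the Cauchy--Schwarz inequality the functional is continuous in the seminorm, so preimages of open
  sets belong to the generator of the sigma-algebra.\<close>
lemma L2_inner_measurable:
  assumes g: "g \<in> L2_space D"
  shows "(\<lambda>f. L2_inner D f g) \<in> borel_measurable (L2_borel D (L2_space D))"
proof (rule borel_measurableI)
  fix S :: "real set" assume S: "open S"
  show "(\<lambda>f. L2_inner D f g) -` S \<inter> space (L2_borel D (L2_space D)) \<in> sets (L2_borel D (L2_space D))"
    unfolding space_L2_borel
  proof (rule L2_borel_open)
    fix u assume u: "u \<in> (\<lambda>f. L2_inner D f g) -` S \<inter> L2_space D"
    then obtain e where e: "e > 0" "\<And>y. dist y (L2_inner D u g) < e \<Longrightarrow> y \<in> S"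
      using S by (auto simp: open_dist)
    have gn: "L2_norm D g + 1 > 0" by (simp add: L2_norm_def L2_inner_def add_nonneg_pos)
    have "v \<in> (\<lambda>f. L2_inner D f g) -` S \<inter> L2_space D"
      if v: "v \<in> L2_space D" "L2_norm D (\<lambda>x. v x - u x) < e / (L2_norm D g + 1)" for v
    proof -
      have "L2_inner D v g - L2_inner D u g = L2_inner D (\<lambda>x. v x - u x) g"
        using L2_product_integrable[OF v(1) g] L2_product_integrable[OF _ g, of u] u
        by (simp add: L2_inner_def left_diff_distrib)
      then have "\<bar>L2_inner D v g - L2_inner D u g\<bar> \<le> L2_norm D (\<lambda>x. v x - u x) * L2_norm D g"
        using L2_Cauchy_Schwarz[OF L2_space_diff g, of v u] v(1) u by simp
      also have "\<dots> \<le> L2_norm D (\<lambda>x. v x - u x) * (L2_norm D g + 1)"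
        by (intro mult_left_mono) (auto simp: L2_norm_def L2_inner_def)
      also have "\<dots> < e" using v(2) gn by (simp add: pos_less_divide_eq)
      finally show ?thesis using e(2) v(1) by (simp add: dist_real_def)
    qed
    then show "\<exists>e>0. \<forall>v\<in>L2_space D. L2_norm D (\<lambda>x. v x - u x) < e \<longrightarrow>
        v \<in> (\<lambda>f. L2_inner D f g) -` S \<inter> L2_space D"
      using e(1) gn by (intro exI[of _ "e / (L2_norm D g + 1)"]) auto
  qed auto
qed

section \<open>The nodal basis of the finite element space\<close>

locale fe_mesh =
  fixes D :: "(real^'d) set" and \<T> :: "(real^'d) set set"
  assumes domain: "polyhedral_domain D"
    and partition: "simplicial_partition D \<T>"
begin

abbreviation V where "V \<equiv> fe_space D \<T>"
abbreviation X where "X \<equiv> nodes \<T>"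
abbreviation vertices :: "(real^'d) set \<Rightarrow> (real^'d) set" where
  "vertices K \<equiv> {x. x extreme_point_of closure K}"

lemma finite_elements: "finite \<T>"
  using partition by (simp add: simplicial_partition_def)

lemma closure_domain: "closure D = (\<Union>K\<in>\<T>. closure K)"
  using partition by (simp add: simplicial_partition_def)

lemma element_simplex:
  assumes "K \<in> \<T>"
  shows "open K" "convex K" "finite (vertices K)" "\<not> affine_dependent (vertices K)"
    "closure K = convex hull (vertices K)" "compact (closure K)"
proof -
  obtain S where S: "int CARD('d) simplex S" "K = interior S"
    using partition assms by (auto simp: simplicial_partition_def)
  obtain C where C: "\<not> affine_dependent C" "S = convex hull C"
    using S(1) by (auto simp: simplex_def)
  have S': "convex S" "compact S" using S(1) by (auto intro: convex_simplex compact_simplex)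
  have "affine hull S = UNIV"
    using aff_dim_simplex[OF S(1)] by (simp flip: aff_dim_eq_full)
  moreover have "S \<noteq> {}" using S(1) by auto
  ultimately have "interior S \<noteq> {}"
    using S'(1) by (metis rel_interior_interior rel_interior_eq_empty)
  then have "closure K = S"
    using S S' convex_closure_interior[of S] by (simp add: compact_imp_closed)
  moreover have "vertices K = C"
    using C \<open>closure K = S\<close> extreme_point_of_convex_hull_affine_independent[OF C(1)] by auto
  ultimately show "open K" "convex K" "finite (vertices K)" "\<not> affine_dependent (vertices K)"
    "closure K = convex hull (vertices K)" "compact (closure K)"
    using C S S' aff_independent_finite by (auto simp: convex_interior)
qed

lemma closure_element_subset: "K \<in> \<T> \<Longrightarrow> closure K \<subseteq> closure D"
  using closure_domain by auto

lemma element_subset: "K \<in> \<T> \<Longrightarrow> K \<subseteq> D"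
proof -
  assume K: "K \<in> \<T>"
  have "interior (closure D) = D"
    using domain by (simp add: polyhedral_domain_def convex_interior_closure interior_open)
  then show ?thesis
    using element_simplex(1)[OF K] closure_element_subset[OF K] closure_subset[of K]
    by (metis interior_maximal order_trans)
qed

lemma finite_nodes: "finite X"
  using finite_elements element_simplex(3) by (auto simp: nodes_def)

lemma vertices_subset_nodes: "K \<in> \<T> \<Longrightarrow> vertices K \<subseteq> X"
  by (auto simp: nodes_def)

lemma fe_affine_on_closed_element:
  assumes "u \<in> V" "K \<in> \<T>"
  shows "\<exists>a b. \<forall>x\<in>closure K. u x = a \<bullet> x + b"
proof -
  obtain a b where ab: "\<And>x. x \<in> K \<Longrightarrow> u x = a \<bullet> x + b"
    using assms by (auto simp: fe_space_def)
  have "continuous_on (closure K) u"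
    using assms closure_element_subset by (auto simp: fe_space_def intro: continuous_on_subset)
  then have cont: "continuous_on (closure K) (\<lambda>x. u x - (a \<bullet> x + b))"
    by (auto intro!: continuous_intros)
  have "u x - (a \<bullet> x + b) = 0" if "x \<in> closure K" for x
    by (rule continuous_constant_on_closure[OF cont _ that]) (use ab in simp)
  then have "\<forall>x\<in>closure K. u x = a \<bullet> x + b" by simp
  then show ?thesis by blast
qed

lemma fe_eqI:
  assumes "u \<in> V" "v \<in> V" "\<And>x. x \<in> X \<Longrightarrow> u x = v x"
  shows "u = v"
proof
  fix x
  show "u x = v x"
  proof (cases "x \<in> closure D")
    case True
    then obtain K where K: "K \<in> \<T>" "x \<in> closure K" using closure_domain by auto
    obtain a b where u: "\<And>x. x \<in> closure K \<Longrightarrow> u x = a \<bullet> x + b"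
      using fe_affine_on_closed_element[OF assms(1) K(1)] by blast
    obtain a' b' where v: "\<And>x. x \<in> closure K \<Longrightarrow> v x = a' \<bullet> x + b'"
      using fe_affine_on_closed_element[OF assms(2) K(1)] by blast
    have "a \<bullet> x + b = a' \<bullet> x + b'"
    proof (rule affine_eq_on_convex_hull)
      fix y assume y: "y \<in> vertices K"
      then have "y \<in> closure K" "y \<in> X"
        using vertices_subset_nodes[OF K(1)] by (auto simp: extreme_point_of_def)
      then show "a \<bullet> y + b = a' \<bullet> y + b'" using u v assms(3) by metis
    qed (use K element_simplex(5) in auto)
    then show ?thesis using u v K(2) by simp
  qed (use assms in \<open>auto simp: fe_space_def\<close>)
qed

text \<open>Interpolate on each simplex by the affine function \<open>x \<mapsto> a K \<bullet> x + b K\<close>. The pieces fit together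
  because the mesh has no hanging nodes: \<open>closure K \<inter> closure L\<close> is a face of both simplices, its
  extreme points are vertices of both simplices, and their convex hull is the face, by the
  Krein--Milman theorem.\<close>
lemma fe_interpolant_exists: "\<exists>v\<in>V. \<forall>x\<in>X. v x = f x"
proof -
  have "\<forall>K\<in>\<T>. \<exists>a b. \<forall>x\<in>vertices K. a \<bullet> x + b = f x"
    using affine_function_with_prescribed_values[OF element_simplex(4)] by metis
  then obtain a b where ab: "\<And>K x. K \<in> \<T> \<Longrightarrow> x \<in> vertices K \<Longrightarrow> a K \<bullet> x + b K = f x"
    by metis
  have agree: "a K \<bullet> x + b K = a L \<bullet> x + b L"
    if "K \<in> \<T>" "L \<in> \<T>" "x \<in> closure K" "x \<in> closure L" for K L x
  proof (rule affine_eq_on_convex_hull)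
    let ?G = "closure K \<inter> closure L"
    have tri: "\<And>A B. A \<in> closure ` \<T> \<Longrightarrow> B \<in> closure ` \<T> \<Longrightarrow> A \<inter> B face_of A"
      using partition unfolding simplicial_partition_def triangulation_def by blast
    have face: "?G face_of closure K" "?G face_of closure L"
      using tri[of "closure K" "closure L"] tri[of "closure L" "closure K"] that(1,2)
      by (auto simp: Int_commute)
    have "convex ?G" "compact ?G"
      using element_simplex(2,6) that(1,2)
      by (auto intro!: convex_Int convex_closure compact_Int)
    then have "?G = convex hull {x. x extreme_point_of ?G}"
      by (intro Krein_Milman_Minkowski)
    then show "x \<in> convex hull {x. x extreme_point_of ?G}" using that(3,4) by blast
    fix y assume "y \<in> {x. x extreme_point_of ?G}"
    then have "y \<in> vertices K" "y \<in> vertices L"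
      using extreme_point_of_face[OF face(1)] extreme_point_of_face[OF face(2)] by auto
    then show "a K \<bullet> y + b K = a L \<bullet> y + b L"
      using ab that(1,2) by metis
  qed
  define k where "k x = (SOME K. K \<in> \<T> \<and> x \<in> closure K)" for x
  define v where "v x = (if x \<in> closure D then a (k x) \<bullet> x + b (k x) else 0)" for x
  have v: "v x = a K \<bullet> x + b K" if K: "K \<in> \<T>" "x \<in> closure K" for K x
  proof -
    have "k x \<in> \<T> \<and> x \<in> closure (k x)" unfolding k_def by (rule someI[of _ K]) (use K in simp)
    then have "a (k x) \<bullet> x + b (k x) = a K \<bullet> x + b K" using agree K by blast
    moreover have "x \<in> closure D" using closure_element_subset K by blast
    ultimately show ?thesis by (simp add: v_def)
  qed
  have "continuous_on (\<Union>K\<in>\<T>. closure K) v"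
  proof (rule continuous_on_closed_Union[OF finite_elements])
    fix K assume "K \<in> \<T>"
    then show "continuous_on (closure K) v"
      by (subst continuous_on_cong[OF refl v]) (auto intro!: continuous_intros)
  qed auto
  then have "continuous_on (closure D) v" by (simp add: closure_domain)
  moreover have "\<forall>x\<in>K. v x = a K \<bullet> x + b K" if "K \<in> \<T>" for K
    using v[OF that] closure_subset by blast
  moreover have "\<forall>x. x \<notin> closure D \<longrightarrow> v x = 0" by (simp add: v_def)
  ultimately have "v \<in> V" unfolding fe_space_def by blast
  moreover have "\<forall>x\<in>X. v x = f x"
  proof
    fix x assume "x \<in> X"
    then obtain K where K: "K \<in> \<T>" "x \<in> vertices K" by (auto simp: nodes_def)
    then have "x \<in> closure K" by (auto simp: extreme_point_of_def)
    then show "v x = f x" using v[OF K(1)] ab[OF K] by simp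
  qed
  ultimately show ?thesis by blast
qed

lemma nodal_interp: "nodal_interp D \<T> f \<in> V" "x \<in> X \<Longrightarrow> nodal_interp D \<T> f x = f x"
proof -
  have "\<exists>!v. v \<in> V \<and> (\<forall>x\<in>X. v x = f x)"
    using fe_interpolant_exists[of f] fe_eqI by (metis (no_types, lifting))
  from theI'[OF this] show "nodal_interp D \<T> f \<in> V" "x \<in> X \<Longrightarrow> nodal_interp D \<T> f x = f x"
    by (auto simp: nodal_interp_def)
qed

definition hat :: "real^'d \<Rightarrow> real^'d \<Rightarrow> real" where
  "hat p = nodal_interp D \<T> (\<lambda>x. if x = p then 1 else 0)"

lemma hat_fe: "hat p \<in> V" and hat_node: "x \<in> X \<Longrightarrow> hat p x = (if x = p then 1 else 0)"
  unfolding hat_def by (rule nodal_interp, simp add: nodal_interp(2))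

lemma fe_sum: "finite J \<Longrightarrow> (\<And>j. j \<in> J \<Longrightarrow> u j \<in> V) \<Longrightarrow> (\<lambda>x. \<Sum>j\<in>J. c j * u j x) \<in> V"
proof -
  assume J: "finite J" and u: "\<And>j. j \<in> J \<Longrightarrow> u j \<in> V"
  have "\<exists>a b. \<forall>x\<in>K. (\<Sum>j\<in>J. c j * u j x) = a \<bullet> x + b" if K: "K \<in> \<T>" for K
  proof -
    have "\<forall>j\<in>J. \<exists>a b. \<forall>x\<in>K. u j x = a \<bullet> x + b" using u K by (auto simp: fe_space_def)
    then obtain a b where ab: "\<And>j x. j \<in> J \<Longrightarrow> x \<in> K \<Longrightarrow> u j x = a j \<bullet> x + b j" by metis
    have "(\<Sum>j\<in>J. c j * u j x) = (\<Sum>j\<in>J. c j *\<^sub>R a j) \<bullet> x + (\<Sum>j\<in>J. c j * b j)" if "x \<in> K" for x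
      using that ab by (simp add: inner_sum_left sum.distrib[symmetric] distrib_left)
    then show ?thesis by blast
  qed
  then have "\<forall>K\<in>\<T>. \<exists>a b. \<forall>x\<in>K. (\<Sum>j\<in>J. c j * u j x) = a \<bullet> x + b" by blast
  moreover have "continuous_on (closure D) (\<lambda>x. \<Sum>j\<in>J. c j * u j x)"
    using u by (intro continuous_intros) (simp add: fe_space_def)
  moreover have "\<forall>x. x \<notin> closure D \<longrightarrow> (\<Sum>j\<in>J. c j * u j x) = 0"
    using u by (simp add: fe_space_def)
  ultimately show ?thesis unfolding fe_space_def by blast
qed

lemma sum_hat_node: "x \<in> X \<Longrightarrow> (\<Sum>p\<in>X. c p * hat p x) = c x"
proof -
  assume x: "x \<in> X"
  have "(\<Sum>p\<in>X. c p * hat p x) = (\<Sum>p\<in>X. if p = x then c x else 0)"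
    using x by (intro sum.cong) (auto simp: hat_node)
  then show ?thesis using x finite_nodes by simp
qed

lemma fe_expansion: "u \<in> V \<Longrightarrow> u = (\<lambda>x. \<Sum>p\<in>X. u p * hat p x)"
  by (rule fe_eqI) (auto simp: sum_hat_node intro!: fe_sum hat_fe finite_nodes)

lemma nodal_interp_expansion: "nodal_interp D \<T> f x = (\<Sum>p\<in>X. f p * hat p x)"
  using fe_expansion[OF nodal_interp(1)[of f]] nodal_interp(2)[of _ f]
  by (metis (no_types, lifting) sum.cong)

text \<open>On a simplex, a hat function is affine with values 0 and 1 at the vertices.\<close>
lemma hat_bounds:
  "hat p x \<in> {0..1}"
proof (cases "x \<in> closure D")
  case True
  then obtain K where K: "K \<in> \<T>" "x \<in> closure K" using closure_domain by auto
  obtain a b where u: "\<And>x. x \<in> closure K \<Longrightarrow> hat p x = a \<bullet> x + b"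
    using fe_affine_on_closed_element[OF hat_fe K(1)] by blast
  have "a \<bullet> x + b \<in> {0..1}"
  proof (rule affine_in_Icc_on_convex_hull)
    fix y assume y: "y \<in> vertices K"
    then have "y \<in> closure K" "y \<in> X"
      using vertices_subset_nodes[OF K(1)] by (auto simp: extreme_point_of_def)
    then have "a \<bullet> y + b = (if y = p then 1 else 0)" using u[of y] hat_node[of y p] by simp
    then show "a \<bullet> y + b \<in> {0..1}" by simp
  qed (use K element_simplex(5) in auto)
  then show ?thesis using u K(2) by simp
qed (use hat_fe in \<open>auto simp: fe_space_def\<close>)

lemma measurable_domain: "D \<in> lmeasurable" "finite_measure (lebesgue_on D)"
proof -
  show "D \<in> lmeasurable"
    using domain by (auto simp: polyhedral_domain_def lmeasurable_open)
  then show "finite_measure (lebesgue_on D)"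
    by (rule finite_measure_lebesgue_on)
qed

lemma fe_measurable: "u \<in> V \<Longrightarrow> u \<in> borel_measurable (lebesgue_on D)"
  using measurable_domain(1) continuous_on_subset[OF _ closure_subset]
  by (intro continuous_imp_measurable_on_sets_lebesgue) (auto simp: fe_space_def)

lemma hat_integrable: "integrable (lebesgue_on D) (hat p)"
  using measurable_domain(2) fe_measurable[OF hat_fe] hat_bounds
  by (auto intro!: finite_measure.integrable_const_bound[where B = 1])

text \<open>The diagonal of the lumped mass matrix.\<close>
definition mass :: "real^'d \<Rightarrow> real" where
  "mass p = (\<integral>x. hat p x \<partial>lebesgue_on D)"

lemma interp_integral_quadrature:
  "interp_integral D \<T> f = (\<Sum>p\<in>X. mass p * f p)"
  unfolding mass_def interp_integral_def nodal_interp_expansion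
  by (subst Bochner_Integration.integral_sum) (auto intro!: hat_integrable simp: mult.commute)

text \<open>A nonnegative function with integral zero vanishes almost everywhere. But the hat function at \<open>p\<close>
  is affine on each simplex with vertex \<open>p\<close> and equals 1 at \<open>p\<close>, hence is positive on the part \<open>?U\<close>
  of the open simplex near \<open>p\<close>, which is not a null set.\<close>
lemma mass_pos:
  assumes "p \<in> X"
  shows "mass p > 0"
proof (rule ccontr)
  assume "\<not> ?thesis"
  moreover have "mass p \<ge> 0"
    unfolding mass_def using hat_bounds by (intro integral_nonneg_AE) auto
  ultimately have "(\<integral>x. hat p x \<partial>lebesgue_on D) = 0" by (simp add: mass_def)
  then have AE: "AE x in lebesgue_on D. hat p x = 0"
    using hat_bounds by (subst (asm) integral_nonneg_eq_0_iff_AE[OF hat_integrable]) auto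
  obtain K where K: "K \<in> \<T>" "p \<in> vertices K" using assms by (auto simp: nodes_def)
  obtain a b where u: "\<And>x. x \<in> closure K \<Longrightarrow> hat p x = a \<bullet> x + b"
    using fe_affine_on_closed_element[OF hat_fe K(1)] by blast
  let ?U = "K \<inter> {x. a \<bullet> x > - b}"
  have pK: "p \<in> closure K" using K(2) by (auto simp: extreme_point_of_def)
  have "open ?U" using element_simplex(1)[OF K(1)] by (intro open_Int open_halfspace_gt)
  moreover have "?U \<noteq> {}"
  proof -
    have "open {x. a \<bullet> x > - b}" by (rule open_halfspace_gt)
    moreover have "p \<in> {x. a \<bullet> x > - b}" using u[OF pK] hat_node[OF assms, of p] by simp
    ultimately show ?thesis using pK by (metis (no_types, lifting) IntI Int_commute closure_iff_nhds_not_empty disjoint_iff order_refl)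
  qed
  ultimately have "\<not> negligible ?U" by (rule open_not_negligible)
  moreover have "negligible ?U"
  proof -
    have "AE x in lebesgue. x \<in> D \<longrightarrow> hat p x = 0"
      using AE measurable_domain by (subst (asm) AE_restrict_space_iff) auto
    then have "AE x in lebesgue. x \<notin> ?U"
      using u element_subset[OF K(1)] closure_subset[of K] by (auto elim!: eventually_mono)
    then have "?U \<in> null_sets lebesgue"
      using \<open>open ?U\<close> by (subst (asm) AE_iff_null_sets[symmetric]) auto
    then show ?thesis by (simp add: negligible_iff_null_sets)
  qed
  ultimately show False by blast
qed

section \<open>The stiffness form\<close>

text \<open>The boundaries of the convex elements are null sets.\<close>
lemma AE_in_element: "AE x in lebesgue_on D. \<exists>K\<in>\<T>. x \<in> K"
proof -
  have "negligible (\<Union>K\<in>\<T>. frontier K)"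
    using finite_elements element_simplex(2) by (intro negligible_Union) (auto intro: negligible_convex_frontier)
  then have "AE x in lebesgue. x \<notin> (\<Union>K\<in>\<T>. frontier K)"
    by (intro AE_not_in) (simp add: negligible_iff_null_sets)
  moreover have "\<exists>K\<in>\<T>. x \<in> K" if "x \<notin> (\<Union>K\<in>\<T>. frontier K)" "x \<in> D" for x
  proof -
    have "x \<in> closure D" using that(2) closure_subset by blast
    then obtain K where "K \<in> \<T>" "x \<in> closure K" using closure_domain by auto
    then show ?thesis using that(1) element_simplex(1) by (auto simp: frontier_def interior_open)
  qed
  ultimately have "AE x in lebesgue. x \<in> D \<longrightarrow> (\<exists>K\<in>\<T>. x \<in> K)"
    by (auto elim: eventually_mono)
  then show ?thesis using measurable_domain(1) by (subst AE_restrict_space_iff) auto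
qed

lemma grad_fe_sum:
  assumes "finite J" "\<And>j. j \<in> J \<Longrightarrow> u j \<in> V" "K \<in> \<T>" "x \<in> K"
  shows "grad (\<lambda>x. \<Sum>j\<in>J. c j * u j x) x = (\<Sum>j\<in>J. c j *\<^sub>R grad (u j) x)"
proof -
  have "\<forall>j\<in>J. \<exists>a b. \<forall>x\<in>K. u j x = a \<bullet> x + b"
    using assms(2,3) unfolding fe_space_def by blast
  then obtain a b where ab: "\<And>j x. j \<in> J \<Longrightarrow> x \<in> K \<Longrightarrow> u j x = a j \<bullet> x + b j" by metis
  have "(\<Sum>j\<in>J. c j * u j y) = (\<Sum>j\<in>J. c j *\<^sub>R a j) \<bullet> y + (\<Sum>j\<in>J. c j * b j)" if "y \<in> K" for y
    using that ab by (simp add: inner_sum_left sum.distrib[symmetric] distrib_left)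
  then have "grad (\<lambda>x. \<Sum>j\<in>J. c j * u j x) x = (\<Sum>j\<in>J. c j *\<^sub>R a j)"
    by (rule grad_affine[OF element_simplex(1)[OF assms(3)] assms(4)])
  also have "\<dots> = (\<Sum>j\<in>J. c j *\<^sub>R grad (u j) x)"
    using grad_affine[OF element_simplex(1)[OF assms(3)] assms(4) ab] by (intro sum.cong) auto
  finally show ?thesis .
qed

text \<open>Outside the elements \<open>grad\<close> has arbitrary values, so the measurability of the integrand also has to
  be obtained from a step function that agrees with it almost everywhere.\<close>
lemma grad_inner_integrable:
  assumes "u \<in> V" "v \<in> V"
  shows "integrable (lebesgue_on D) (\<lambda>x. grad u x \<bullet> grad v x)"
proof -
  have const: "\<exists>a. \<forall>K\<in>\<T>. \<forall>x\<in>K. grad w x = a K" if w: "w \<in> V" for w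
  proof (rule bchoice, rule ballI)
    fix K assume K: "K \<in> \<T>"
    then obtain a b where "\<And>y. y \<in> K \<Longrightarrow> w y = a \<bullet> y + b"
      using w unfolding fe_space_def by blast
    then have "\<forall>x\<in>K. grad w x = a"
      using grad_affine[OF element_simplex(1)[OF K]] by blast
    then show "\<exists>a. \<forall>x\<in>K. grad w x = a" ..
  qed
  obtain a where a: "\<forall>K\<in>\<T>. \<forall>x\<in>K. grad u x = a K" using const[OF assms(1)] ..
  obtain a' where a': "\<forall>K\<in>\<T>. \<forall>x\<in>K. grad v x = a' K" using const[OF assms(2)] ..
  \<comment> \<open>the step function that agrees with the integrand on every element, hence almost everywhere\<close>
  define s where "s x = (\<Sum>K\<in>\<T>. indicator K x * (a K \<bullet> a' K))" for x
  have s: "s x = grad u x \<bullet> grad v x" if K: "K \<in> \<T>" "x \<in> K" for K x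
  proof -
    have "x \<notin> L" if "L \<in> \<T>" "L \<noteq> K" for L
    proof -
      have "disjoint \<T>" using partition by (simp add: simplicial_partition_def)
      then have "L \<inter> K = {}" using that K(1) by (simp add: disjoint_def)
      then show ?thesis using K(2) by blast
    qed
    then have "s x = (\<Sum>L\<in>\<T>. if L = K then a K \<bullet> a' K else 0)"
      unfolding s_def using K by (intro sum.cong) auto
    then show ?thesis using K a a' finite_elements by simp
  qed
  have AE: "AE x in lebesgue_on D. s x = grad u x \<bullet> grad v x"
    using AE_in_element s by (auto elim!: eventually_mono)
  have [measurable]: "K \<in> sets lebesgue" if "K \<in> \<T>" for K
    using element_simplex(1)[OF that] by auto
  have s_meas: "s \<in> borel_measurable lebesgue"
    unfolding s_def by measurable
  have D: "D \<in> sets lebesgue" using measurable_domain(1) by auto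
  have "(\<lambda>x. if x \<in> D then s x else 0) \<in> borel_measurable lebesgue"
    using D s_meas by (intro measurable_If_set) auto
  moreover have "AE x in lebesgue. (if x \<in> D then s x else 0) = (if x \<in> D then grad u x \<bullet> grad v x else 0)"
    using AE D by (subst (asm) AE_restrict_space_iff) (auto elim!: eventually_mono)
  ultimately have "(\<lambda>x. if x \<in> D then grad u x \<bullet> grad v x else 0) \<in> borel_measurable lebesgue"
    by (rule borel_measurable_AE)
  then have "(\<lambda>x. grad u x \<bullet> grad v x) \<in> borel_measurable (lebesgue_on D)"
    using borel_measurable_if[OF D] by blast
  moreover have "AE x in lebesgue_on D. norm (grad u x \<bullet> grad v x) \<le> (\<Sum>K\<in>\<T>. \<bar>a K \<bullet> a' K\<bar>)"
  proof -
    have s_bound: "norm (s x) \<le> (\<Sum>K\<in>\<T>. \<bar>a K \<bullet> a' K\<bar>)" for x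
      unfolding s_def by (rule order_trans[OF norm_sum]) (auto intro!: sum_mono simp: indicator_def)
    show ?thesis using AE
    proof (rule eventually_mono)
      fix x assume "s x = grad u x \<bullet> grad v x"
      then show "norm (grad u x \<bullet> grad v x) \<le> (\<Sum>K\<in>\<T>. \<bar>a K \<bullet> a' K\<bar>)"
        using s_bound[of x] by simp
    qed
  qed
  ultimately show ?thesis
    by (intro finite_measure.integrable_const_bound[OF measurable_domain(2)])
qed

definition stiffness :: "(real^'d \<Rightarrow> real) \<Rightarrow> (real^'d \<Rightarrow> real) \<Rightarrow> real" where
  "stiffness u v = (\<integral>x. grad u x \<bullet> grad v x \<partial>lebesgue_on D)"

lemma stiffness_commute: "stiffness u v = stiffness v u"
  by (simp add: stiffness_def inner_commute)

lemma stiffness_nonneg: "stiffness u u \<ge> 0"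
  by (simp add: stiffness_def)

lemma stiffness_sum_left:
  assumes "finite J" "\<And>j. j \<in> J \<Longrightarrow> u j \<in> V" "v \<in> V"
  shows "stiffness (\<lambda>x. \<Sum>j\<in>J. c j * u j x) v = (\<Sum>j\<in>J. c j * stiffness (u j) v)"
proof -
  have int: "integrable (lebesgue_on D) (\<lambda>x. c j * (grad (u j) x \<bullet> grad v x))" if "j \<in> J" for j
    using grad_inner_integrable[OF assms(2)[OF that] assms(3)] by simp
  have "stiffness (\<lambda>x. \<Sum>j\<in>J. c j * u j x) v
      = (\<integral>x. (\<Sum>j\<in>J. c j * (grad (u j) x \<bullet> grad v x)) \<partial>lebesgue_on D)"
    unfolding stiffness_def
  proof (rule integral_cong_AE)
    show "(\<lambda>x. grad (\<lambda>x. \<Sum>j\<in>J. c j * u j x) x \<bullet> grad v x) \<in> borel_measurable (lebesgue_on D)"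
      using assms by (intro borel_measurable_integrable grad_inner_integrable fe_sum)
    show "(\<lambda>x. \<Sum>j\<in>J. c j * (grad (u j) x \<bullet> grad v x)) \<in> borel_measurable (lebesgue_on D)"
      using int by (intro borel_measurable_integrable Bochner_Integration.integrable_sum)
    show "AE x in lebesgue_on D. grad (\<lambda>x. \<Sum>j\<in>J. c j * u j x) x \<bullet> grad v x
        = (\<Sum>j\<in>J. c j * (grad (u j) x \<bullet> grad v x))"
      using AE_in_element by (rule eventually_mono) (auto simp: grad_fe_sum[OF assms(1,2)] inner_sum_left)
  qed
  also have "\<dots> = (\<Sum>j\<in>J. c j * stiffness (u j) v)"
    using int by (subst Bochner_Integration.integral_sum) (auto simp: stiffness_def)
  finally show ?thesis .
qed

lemma stiffness_expansion:
  assumes "v \<in> V"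
  shows "stiffness (\<lambda>x. \<Sum>p\<in>X. c p * hat p x) v
    = (\<Sum>q\<in>X. (\<Sum>p\<in>X. stiffness (hat q) (hat p) * c p) * v q)"
proof -
  have "stiffness (\<lambda>x. \<Sum>p\<in>X. c p * hat p x) v = (\<Sum>p\<in>X. c p * stiffness (hat p) v)"
    by (rule stiffness_sum_left[OF finite_nodes hat_fe assms])
  also have "\<dots> = (\<Sum>p\<in>X. c p * stiffness v (hat p))"
    by (simp only: stiffness_commute)
  also have "\<dots> = (\<Sum>p\<in>X. c p * (\<Sum>q\<in>X. v q * stiffness (hat q) (hat p)))"
    by (subst fe_expansion[OF assms]) (simp only: stiffness_sum_left[OF finite_nodes hat_fe hat_fe])
  also have "\<dots> = (\<Sum>p\<in>X. \<Sum>q\<in>X. stiffness (hat q) (hat p) * c p * v q)"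
    by (simp only: sum_distrib_left mult_ac)
  also have "\<dots> = (\<Sum>q\<in>X. \<Sum>p\<in>X. stiffness (hat q) (hat p) * c p * v q)"
    by (rule sum.swap)
  finally show ?thesis by (simp only: sum_distrib_right)
qed

section \<open>Measurable maps into the finite element space\<close>

lemma L2_norm_hat_sum:
  assumes "finite J"
  shows "L2_norm D (\<lambda>x. \<Sum>j\<in>J. d j * hat (e j) x) \<le> sqrt (measure lebesgue D) * (\<Sum>j\<in>J. \<bar>d j\<bar>)"
proof -
  let ?u = "\<lambda>x. \<Sum>j\<in>J. d j * hat (e j) x" and ?s = "\<Sum>j\<in>J. \<bar>d j\<bar>"
  have u: "\<bar>?u x\<bar> \<le> ?s" for x
  proof (rule order_trans[OF sum_abs sum_mono])
    show "\<bar>d j * hat (e j) x\<bar> \<le> \<bar>d j\<bar>" for j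
      using hat_bounds[of "e j" x] by (auto simp: abs_mult intro: mult_left_le)
  qed
  have "L2_inner D ?u ?u \<le> (\<integral>x. ?s * ?s \<partial>lebesgue_on D)"
    unfolding L2_inner_def
  proof (rule integral_mono')
    show "integrable (lebesgue_on D) (\<lambda>x. ?s * ?s)"
      by (rule finite_measure.integrable_const[OF measurable_domain(2)])
    show "?u x * ?u x \<le> ?s * ?s" for x
    proof -
      have "\<bar>?u x\<bar> * \<bar>?u x\<bar> \<le> ?s * ?s"
        by (intro mult_mono u sum_nonneg abs_ge_zero)
      then show ?thesis by (simp only: abs_mult_self_eq)
    qed
  qed simp
  also have "\<dots> = measure lebesgue D * ?s\<^sup>2"
    using measurable_domain(1) by (simp add: measure_restrict_space power2_eq_square)
  finally have "L2_norm D ?u \<le> sqrt (measure lebesgue D * ?s\<^sup>2)"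
    unfolding L2_norm_def by (rule real_sqrt_le_mono)
  also have "\<dots> = sqrt (measure lebesgue D) * ?s"
    by (simp add: real_sqrt_mult sum_nonneg)
  finally show ?thesis .
qed

text \<open>The map \<open>H\<close> from coefficients to finite element functions is continuous from the product topology
  to the \<open>L\<^sup>2\<close> norm, so preimages of sets open in that norm are open.\<close>
lemma measurable_into_L2_borel:
  assumes c: "\<And>p. p \<in> X \<Longrightarrow> (\<lambda>\<omega>. c \<omega> p) \<in> borel_measurable N"
  shows "(\<lambda>\<omega> x. \<Sum>p\<in>X. c \<omega> p * hat p x) \<in> measurable N (L2_borel D V)"
proof -
  \<comment> \<open>With the nodes enumerated, coefficients are points of \<open>nat \<Rightarrow> real\<close>, whose Borel
    sigma-algebra is generated by the coordinates.\<close>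
  obtain e where e: "bij_betw e {..<card X} X"
    using ex_bij_betw_nat_finite[OF finite_nodes] by (auto simp: atLeast0LessThan)
  define q where "q \<omega> i = (if i < card X then c \<omega> (e i) else 0)" for \<omega> and i :: nat
  define H where "H y x = (\<Sum>i<card X. y i * hat (e i) x)" for y :: "nat \<Rightarrow> real" and x
  have H_fe: "H y \<in> V" for y
    unfolding H_def by (intro fe_sum hat_fe) simp
  have target: "H (q \<omega>) = (\<lambda>x. \<Sum>p\<in>X. c \<omega> p * hat p x)" for \<omega>
    unfolding H_def q_def
    by (auto intro!: ext simp: sum.reindex_bij_betw[OF e, symmetric])
  have q: "q \<in> borel_measurable N"
  proof (rule measurable_coordinatewise_then_product)
    fix i
    show "(\<lambda>\<omega>. q \<omega> i) \<in> borel_measurable N"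
      using c[of "e i"] e by (cases "i < card X") (auto simp: q_def bij_betw_def)
  qed
  have "(\<lambda>\<omega>. H (q \<omega>)) \<in> measurable N (L2_borel D V)"
    unfolding L2_borel_def
  proof (rule measurable_measure_of)
    fix A assume A: "A \<in> {A. A \<subseteq> V \<and> (\<forall>u\<in>A. \<exists>e>0. \<forall>v\<in>V. L2_norm D (\<lambda>x. v x - u x) < e \<longrightarrow> v \<in> A)}"
    have "open (H -` A)"
    proof (subst open_subopen, intro ballI)
      fix y assume "y \<in> H -` A"
      then obtain \<epsilon> where \<epsilon>: "\<epsilon> > 0" "\<And>v. v \<in> V \<Longrightarrow> L2_norm D (\<lambda>x. v x - H y x) < \<epsilon> \<Longrightarrow> v \<in> A"
        using A by blast
      let ?U = "{z. sqrt (measure lebesgue D) * (\<Sum>i<card X. \<bar>z i - y i\<bar>) < \<epsilon>}"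
      have "open ?U"
        by (intro open_Collect_less continuous_intros continuous_on_product_coordinates)
      moreover have "y \<in> ?U" using \<epsilon>(1) by simp
      moreover have "?U \<subseteq> H -` A"
      proof
        fix z assume z: "z \<in> ?U"
        have "(\<lambda>x. H z x - H y x) = (\<lambda>x. \<Sum>i<card X. (z i - y i) * hat (e i) x)"
          by (simp add: H_def sum_subtractf left_diff_distrib)
        then have "L2_norm D (\<lambda>x. H z x - H y x) < \<epsilon>"
          using z L2_norm_hat_sum[of "{..<card X}" "\<lambda>i. z i - y i" e] by simp
        then show "z \<in> H -` A" using \<epsilon>(2) H_fe by simp
      qed
      ultimately show "\<exists>U. open U \<and> y \<in> U \<and> U \<subseteq> H -` A" by blast
    qed
    then have "q -` (H -` A) \<inter> space N \<in> sets N"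
      using q by (intro measurable_sets[OF q]) auto
    then show "(\<lambda>\<omega>. H (q \<omega>)) -` A \<inter> space N \<in> sets N"
      by (simp add: vimage_def)
  qed (auto simp: H_fe)
  then show ?thesis by (simp add: target)
qed

section \<open>Solving one step of the scheme\<close>

text \<open>Testing the backward Euler operator of the heat equation with the function it is applied to. For
  \<open>\<tau> \<ge> 0\<close> the right-hand side is positive unless \<open>c\<close> vanishes at all nodes.\<close>
lemma implicit_heat_step_energy:
  "(\<Sum>q\<in>X. (mass q * c q + \<tau> * (\<Sum>p\<in>X. stiffness (hat q) (hat p) * c p)) * c q)
    = (\<Sum>q\<in>X. mass q * (c q)\<^sup>2)
      + \<tau> * stiffness (\<lambda>x. \<Sum>p\<in>X. c p * hat p x) (\<lambda>x. \<Sum>p\<in>X. c p * hat p x)"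
proof -
  let ?u = "\<lambda>x. \<Sum>p\<in>X. c p * hat p x"
  have u: "?u \<in> V" by (intro fe_sum finite_nodes hat_fe)
  define A where "A q = (\<Sum>p\<in>X. stiffness (hat q) (hat p) * c p)" for q
  have "stiffness ?u ?u = (\<Sum>q\<in>X. A q * c q)"
    unfolding stiffness_expansion[OF u] A_def by (intro sum.cong refl) (simp only: sum_hat_node)
  moreover have "(\<Sum>q\<in>X. (mass q * c q + \<tau> * A q) * c q)
      = (\<Sum>q\<in>X. mass q * (c q)\<^sup>2 + \<tau> * (A q * c q))"
    by (intro sum.cong refl) (simp add: power2_eq_square algebra_simps)
  ultimately show ?thesis
    by (simp add: A_def[symmetric] sum.distrib sum_distrib_left)
qed

text \<open>What matters is that one deterministic matrix \<open>G\<close> serves all right-hand sides: then the solution is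
  a fixed linear combination of the data \<open>b\<close>, and measurable when they are.\<close>
lemma implicit_heat_step_inverse:
  assumes "\<tau> \<ge> 0"
  shows "\<exists>G. \<forall>b. \<forall>q\<in>X. mass q * (\<Sum>y\<in>X. b y * G y q)
      + \<tau> * (\<Sum>p\<in>X. stiffness (hat q) (hat p) * (\<Sum>y\<in>X. b y * G y p)) = b q"
proof -
  \<comment> \<open>lumped mass matrix plus \<open>\<tau>\<close> times stiffness matrix\<close>
  define S where "S q p = (if q = p then mass q else 0) + \<tau> * stiffness (hat q) (hat p)" for q p
  have S_sum: "(\<Sum>p\<in>X. S q p * c p) = mass q * c q + \<tau> * (\<Sum>p\<in>X. stiffness (hat q) (hat p) * c p)"
    if "q \<in> X" for c q
  proof -
    have "(\<Sum>p\<in>X. S q p * c p)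
        = (\<Sum>p\<in>X. (if q = p then mass q * c q else 0) + \<tau> * (stiffness (hat q) (hat p) * c p))"
      by (intro sum.cong) (auto simp: S_def distrib_right)
    then show ?thesis
      using that finite_nodes by (simp add: sum.distrib sum_distrib_left)
  qed
  have "(\<Sum>q\<in>X. \<Sum>p\<in>X. S q p * c q * c p) > 0" if nz: "\<exists>q\<in>X. c q \<noteq> 0" for c
  proof -
    let ?u = "\<lambda>x. \<Sum>p\<in>X. c p * hat p x"
    have "(\<Sum>q\<in>X. \<Sum>p\<in>X. S q p * c q * c p) = (\<Sum>q\<in>X. (\<Sum>p\<in>X. S q p * c p) * c q)"
      unfolding sum_distrib_right by (intro sum.cong refl) simp
    also have "\<dots> = (\<Sum>q\<in>X. mass q * (c q)\<^sup>2) + \<tau> * stiffness ?u ?u"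
      by (simp add: S_sum implicit_heat_step_energy)
    also have "\<dots> > 0"
    proof (rule add_pos_nonneg)
      obtain q where q: "q \<in> X" "c q \<noteq> 0" using nz by blast
      have "mass p > 0" if "p \<in> X" for p by (rule mass_pos[OF that])
      then show "(\<Sum>q\<in>X. mass q * (c q)\<^sup>2) > 0"
        using q by (intro sum_pos2[OF finite_nodes q(1)]) (auto simp: less_imp_le)
    qed (simp add: assms stiffness_nonneg)
    finally show ?thesis .
  qed
  then have "\<exists>c. \<forall>q\<in>X. (\<Sum>p\<in>X. S q p * c p) = b q" for b :: "real^'d \<Rightarrow> real"
    by (intro pos_def_system_solvable finite_nodes) (auto simp: S_def stiffness_commute)
  then have "\<exists>c. \<forall>q\<in>X. (\<Sum>p\<in>X. S q p * c p) = (if q = y then 1 else 0)" for y .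
  \<comment> \<open>\<open>G y\<close> solves the system whose right-hand side is the unit vector at the node \<open>y\<close>\<close>
  then obtain G where G: "\<And>y q. q \<in> X \<Longrightarrow> (\<Sum>p\<in>X. S q p * G y p) = (if q = y then 1 else 0)"
    by metis
  have "mass q * (\<Sum>y\<in>X. b y * G y q)
      + \<tau> * (\<Sum>p\<in>X. stiffness (hat q) (hat p) * (\<Sum>y\<in>X. b y * G y p)) = b q"
    if q: "q \<in> X" for b q
  proof -
    have "(\<Sum>p\<in>X. S q p * (\<Sum>y\<in>X. b y * G y p)) = (\<Sum>p\<in>X. \<Sum>y\<in>X. b y * (S q p * G y p))"
      unfolding sum_distrib_left by (intro sum.cong refl) simp
    also have "\<dots> = (\<Sum>y\<in>X. b y * (\<Sum>p\<in>X. S q p * G y p))"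
      by (subst sum.swap) (simp only: sum_distrib_left)
    also have "\<dots> = (\<Sum>y\<in>X. if q = y then b q else 0)"
      using q by (intro sum.cong) (auto simp: G)
    also have "\<dots> = b q" using q finite_nodes by simp
    finally show ?thesis unfolding S_sum[OF q] .
  qed
  then show ?thesis by blast
qed

text \<open>The elimination of \<open>r\<close> described at the beginning. The solution is given by functions \<open>\<Phi>\<close> and \<open>\<rho>\<close>
  of the stochastic increment and of the previous solution, chosen before any probability enters, so
  that measurability can be asserted for every sigma-algebra for which the data are measurable.\<close>
lemma scheme_step_measurable_solution:
  assumes "\<tau> \<ge> 0"
    and F: "F \<in> borel_measurable borel" "deriv F \<in> borel_measurable borel"
      "deriv (deriv F) \<in> borel_measurable borel"
  shows "\<exists>(\<Phi> :: (real^'d \<Rightarrow> real) \<Rightarrow> (real^'d \<Rightarrow> real) \<Rightarrow> real \<Rightarrow> real^'d \<Rightarrow> real)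
      (\<rho> :: (real^'d \<Rightarrow> real) \<Rightarrow> (real^'d \<Rightarrow> real) \<Rightarrow> real \<Rightarrow> real).
    (\<forall>B u s. \<Phi> B u s \<in> V \<and> scheme_step D \<T> F \<tau> B u s (\<Phi> B u s) (\<rho> B u s)) \<and>
    (\<forall>(N :: 'w measure) B u s.
       (\<forall>q\<in>X. (\<lambda>\<omega>. B \<omega> q) \<in> borel_measurable N) \<longrightarrow>
       (\<forall>q\<in>X. (\<lambda>\<omega>. u \<omega> q) \<in> borel_measurable N) \<longrightarrow> s \<in> borel_measurable N \<longrightarrow>
       (\<forall>p\<in>X. (\<lambda>\<omega>. \<Phi> (B \<omega>) (u \<omega>) (s \<omega>) p) \<in> borel_measurable N) \<and>
       (\<lambda>\<omega>. \<rho> (B \<omega>) (u \<omega>) (s \<omega>)) \<in> borel_measurable N)"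
proof -
  obtain G where G: "\<And>b q. q \<in> X \<Longrightarrow> mass q * (\<Sum>y\<in>X. b y * G y q)
      + \<tau> * (\<Sum>p\<in>X. stiffness (hat q) (hat p) * (\<Sum>y\<in>X. b y * G y p)) = b q"
    using implicit_heat_step_inverse[OF assms(1)] by blast
  define R where "R b p = (\<Sum>y\<in>X. b y * G y p)" for b :: "real^'d \<Rightarrow> real" and p
  have R: "mass q * R b q + \<tau> * (\<Sum>p\<in>X. stiffness (hat q) (hat p) * R b p) = b q"
    if "q \<in> X" for b q
    unfolding R_def by (rule G[OF that])
  \<comment> \<open>\<open>l B u p\<close> is the weight at the node \<open>p\<close> in the functional \<open>L\<close> that occurs in both equations, and
    \<open>b B u p\<close> that in \<open>\<psi> \<mapsto> (B + u, \<psi>)\<^sub>h\<close>; \<open>\<rho>\<close> and \<open>c\<close> are the result of eliminating the nodal values from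
    the second equation by means of the first.\<close>
  define E where "E u = (\<Sum>p\<in>X. mass p * F (u p))" for u :: "real^'d \<Rightarrow> real"
  define A where "A B u = (\<Sum>p\<in>X. mass p * (deriv F (u p) * B p))" for B u :: "real^'d \<Rightarrow> real"
  define \<alpha> where "\<alpha> B u = 1 / sqrt (E u) - A B u / (4 * E u powr (3/2))" for B u
  define \<beta> where "\<beta> u = 1 / (2 * sqrt (E u))" for u
  define l where "l B u p = mass p * (\<alpha> B u * deriv F (u p) + \<beta> u * (deriv (deriv F) (u p) * B p))"
    for B u p
  define b where "b B u p = mass p * (B p + u p)" for B u :: "real^'d \<Rightarrow> real" and p
  define \<rho> where "\<rho> B u s =
      (s - (\<Sum>p\<in>X. l B u p * u p) / 2 + (\<Sum>p\<in>X. l B u p * R (b B u) p) / 2)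
        / (1 + \<tau> * (\<Sum>p\<in>X. l B u p * R (l B u) p) / 2)" for B u s
  define c where "c B u s p = R (b B u) p - \<tau> * \<rho> B u s * R (l B u) p" for B u s p
  define \<Phi> where "\<Phi> B u s x = (\<Sum>p\<in>X. c B u s p * hat p x)" for B u s x
  have \<Phi>_fe: "\<Phi> B u s \<in> V" for B u s
    unfolding \<Phi>_def by (intro fe_sum finite_nodes hat_fe)
  have \<Phi>_node: "\<Phi> B u s p = c B u s p" if "p \<in> X" for B u s p
    using that by (simp add: \<Phi>_def sum_hat_node)
  have l_functional: "(\<Sum>p\<in>X. l B u p * f p) = \<alpha> B u * (\<Sum>p\<in>X. mass p * (deriv F (u p) * f p))
      + \<beta> u * (\<Sum>p\<in>X. mass p * (deriv (deriv F) (u p) * B p * f p))" for B u f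
    by (simp add: l_def sum_distrib_left sum.distrib[symmetric] algebra_simps)
  have "scheme_step D \<T> F \<tau> B u s (\<Phi> B u s) (\<rho> B u s)" for B u s
  proof -
    let ?r = "\<rho> B u s" and ?l = "l B u"
    \<comment> \<open>\<open>L (R L) = S (R L) (R L)\<close>\<close>
    have R_form: "(\<Sum>q\<in>X. ?l q * R ?l q) \<ge> 0"
    proof -
      let ?v = "\<lambda>x. \<Sum>p\<in>X. R ?l p * hat p x"
      have "(\<Sum>q\<in>X. ?l q * R ?l q)
          = (\<Sum>q\<in>X. (mass q * R ?l q + \<tau> * (\<Sum>p\<in>X. stiffness (hat q) (hat p) * R ?l p)) * R ?l q)"
        by (simp add: R)
      also have "\<dots> = (\<Sum>q\<in>X. mass q * (R ?l q)\<^sup>2) + \<tau> * stiffness ?v ?v"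
        by (rule implicit_heat_step_energy)
      also have "\<dots> \<ge> 0"
        using assms(1) mass_pos
        by (intro add_nonneg_nonneg sum_nonneg mult_nonneg_nonneg)
          (auto simp: stiffness_nonneg intro: less_imp_le)
      finally show ?thesis .
    qed
    have "1 + \<tau> * (\<Sum>q\<in>X. ?l q * R ?l q) / 2 > 0"
      using mult_nonneg_nonneg[OF assms(1) R_form] by simp
    then have r_eq: "?r * (1 + \<tau> * (\<Sum>q\<in>X. ?l q * R ?l q) / 2)
        = s - (\<Sum>p\<in>X. ?l p * u p) / 2 + (\<Sum>p\<in>X. ?l p * R (b B u) p) / 2"
      unfolding \<rho>_def by simp
    have "(\<Sum>p\<in>X. ?l p * (\<Phi> B u s p - u p))
        = (\<Sum>p\<in>X. ?l p * R (b B u) p - \<tau> * ?r * (?l p * R ?l p) - ?l p * u p)"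
      by (intro sum.cong) (auto simp: \<Phi>_node c_def algebra_simps)
    also have "\<dots> = (\<Sum>p\<in>X. ?l p * R (b B u) p) - \<tau> * ?r * (\<Sum>p\<in>X. ?l p * R ?l p)
        - (\<Sum>p\<in>X. ?l p * u p)"
      by (simp only: sum_subtractf sum_distrib_left)
    finally have second: "?r - s = (\<Sum>p\<in>X. ?l p * (\<Phi> B u s p - u p)) / 2"
      using r_eq by (simp add: field_simps)
    have c_eq: "mass q * c B u s q + \<tau> * (\<Sum>p\<in>X. stiffness (hat q) (hat p) * c B u s p)
        = b B u q - \<tau> * ?r * ?l q" if "q \<in> X" for q
    proof -
      have "mass q * c B u s q + \<tau> * (\<Sum>p\<in>X. stiffness (hat q) (hat p) * c B u s p)
        = (mass q * R (b B u) q + \<tau> * (\<Sum>p\<in>X. stiffness (hat q) (hat p) * R (b B u) p))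
          - \<tau> * ?r * (mass q * R ?l q + \<tau> * (\<Sum>p\<in>X. stiffness (hat q) (hat p) * R ?l p))"
        by (simp add: c_def algebra_simps sum_subtractf sum_distrib_left)
      then show ?thesis by (simp add: R[OF that])
    qed
    have first: "(\<Sum>p\<in>X. mass p * ((\<Phi> B u s p - u p) * \<psi> p)) + \<tau> * stiffness (\<Phi> B u s) \<psi>
        + \<tau> * ?r * (\<Sum>p\<in>X. ?l p * \<psi> p) = (\<Sum>p\<in>X. mass p * (B p * \<psi> p))" if "\<psi> \<in> V" for \<psi>
    proof -
      have "stiffness (\<Phi> B u s) \<psi> = (\<Sum>q\<in>X. (\<Sum>p\<in>X. stiffness (hat q) (hat p) * c B u s p) * \<psi> q)"
        unfolding \<Phi>_def by (rule stiffness_expansion[OF that])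
      then have "(\<Sum>p\<in>X. mass p * ((\<Phi> B u s p - u p) * \<psi> p)) + \<tau> * stiffness (\<Phi> B u s) \<psi>
            + \<tau> * ?r * (\<Sum>p\<in>X. ?l p * \<psi> p)
          = (\<Sum>q\<in>X. mass q * ((\<Phi> B u s q - u q) * \<psi> q)
            + \<tau> * ((\<Sum>p\<in>X. stiffness (hat q) (hat p) * c B u s p) * \<psi> q) + \<tau> * ?r * (?l q * \<psi> q))"
        by (simp only: sum.distrib sum_distrib_left)
      also have "\<dots> = (\<Sum>q\<in>X. (mass q * c B u s q
            + \<tau> * (\<Sum>p\<in>X. stiffness (hat q) (hat p) * c B u s p) + \<tau> * ?r * ?l q - mass q * u q) * \<psi> q)"
        by (intro sum.cong) (auto simp: \<Phi>_node algebra_simps)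
      also have "\<dots> = (\<Sum>q\<in>X. mass q * (B q * \<psi> q))"
      proof (intro sum.cong refl)
        fix q assume q: "q \<in> X"
        have "mass q * c B u s q + \<tau> * (\<Sum>p\<in>X. stiffness (hat q) (hat p) * c B u s p)
            + \<tau> * ?r * ?l q - mass q * u q = mass q * B q"
          unfolding c_eq[OF q] by (simp add: b_def distrib_left)
        then show "(mass q * c B u s q + \<tau> * (\<Sum>p\<in>X. stiffness (hat q) (hat p) * c B u s p)
            + \<tau> * ?r * ?l q - mass q * u q) * \<psi> q = mass q * (B q * \<psi> q)"
          by simp
      qed
      finally show ?thesis .
    qed
    have energy: "discrete_energy D \<T> F u = E u"
      by (simp add: discrete_energy_def interp_integral_quadrature E_def)
    have \<alpha>_half: "1 / (2 * sqrt (E u)) - A B u / (8 * E u powr (3/2)) = \<alpha> B u / 2"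
      by (simp add: \<alpha>_def diff_divide_distrib)
    have \<beta>_half: "1 / (4 * sqrt (E u)) = \<beta> u / 2" by (simp add: \<beta>_def)
    have \<beta>: "x / (2 * sqrt (E u)) = x * \<beta> u" for x by (simp add: \<beta>_def)
    have swap: "deriv (deriv F) (u p) * (\<Phi> B u s p - u p) * B p
        = deriv (deriv F) (u p) * B p * (\<Phi> B u s p - u p)" for p by simp
    have A: "interp_integral D \<T> (\<lambda>x. deriv F (u x) * B x) = A B u"
      by (simp add: interp_integral_quadrature A_def)
    show ?thesis
      unfolding scheme_step_def Let_def energy A
      unfolding interp_integral_quadrature stiffness_def[symmetric] \<alpha>_def[symmetric] \<alpha>_half \<beta>_half
      unfolding \<beta> swap
    proof (intro conjI ballI)
      fix \<psi> assume "\<psi> \<in> V"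
      from first[OF this, unfolded l_functional]
      show "(\<Sum>p\<in>X. mass p * ((\<Phi> B u s p - u p) * \<psi> p)) + \<tau> * stiffness (\<Phi> B u s) \<psi>
          + \<tau> * ?r * \<alpha> B u * (\<Sum>p\<in>X. mass p * (deriv F (u p) * \<psi> p))
          + \<tau> * ?r * \<beta> u * (\<Sum>p\<in>X. mass p * (deriv (deriv F) (u p) * B p * \<psi> p))
          = (\<Sum>p\<in>X. mass p * (B p * \<psi> p))"
        by (simp only: distrib_left mult.assoc add.assoc)
    next
      from second[unfolded l_functional]
      show "?r - s = \<alpha> B u / 2 * (\<Sum>p\<in>X. mass p * (deriv F (u p) * (\<Phi> B u s p - u p)))
          + \<beta> u / 2 * (\<Sum>p\<in>X. mass p * (deriv (deriv F) (u p) * B p * (\<Phi> B u s p - u p)))"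
        by (simp add: add_divide_distrib)
    qed
  qed
  moreover have "(\<forall>p\<in>X. (\<lambda>\<omega>. \<Phi> (B \<omega>) (u \<omega>) (s \<omega>) p) \<in> borel_measurable N) \<and>
       (\<lambda>\<omega>. \<rho> (B \<omega>) (u \<omega>) (s \<omega>)) \<in> borel_measurable N"
    if B: "\<forall>q\<in>X. (\<lambda>\<omega>. B \<omega> q) \<in> borel_measurable N"
      and u: "\<forall>q\<in>X. (\<lambda>\<omega>. u \<omega> q) \<in> borel_measurable N"
      and s[measurable]: "s \<in> borel_measurable N" for B u s and N :: "'w measure"
  proof -
    note F[measurable]
    have [measurable]: "(\<lambda>\<omega>. B \<omega> q) \<in> borel_measurable N" "(\<lambda>\<omega>. u \<omega> q) \<in> borel_measurable N"
      if "q \<in> X" for q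
      using B u that by auto
    have [measurable]: "(\<lambda>\<omega>. E (u \<omega>)) \<in> borel_measurable N"
      unfolding E_def by measurable
    have [measurable]: "(\<lambda>\<omega>. A (B \<omega>) (u \<omega>)) \<in> borel_measurable N"
      unfolding A_def by measurable
    have [measurable]: "(\<lambda>\<omega>. l (B \<omega>) (u \<omega>) q) \<in> borel_measurable N" if [measurable]: "q \<in> X" for q
      unfolding l_def \<alpha>_def \<beta>_def by measurable
    have [measurable]: "(\<lambda>\<omega>. b (B \<omega>) (u \<omega>) q) \<in> borel_measurable N" if [measurable]: "q \<in> X" for q
      unfolding b_def by measurable
    have [measurable]: "(\<lambda>\<omega>. R (l (B \<omega>) (u \<omega>)) p) \<in> borel_measurable N"
        "(\<lambda>\<omega>. R (b (B \<omega>) (u \<omega>)) p) \<in> borel_measurable N" for p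
      unfolding R_def by measurable
    have [measurable]: "(\<lambda>\<omega>. \<rho> (B \<omega>) (u \<omega>) (s \<omega>)) \<in> borel_measurable N"
      unfolding \<rho>_def by measurable
    moreover have "(\<lambda>\<omega>. c (B \<omega>) (u \<omega>) (s \<omega>) p) \<in> borel_measurable N" for p
      unfolding c_def by measurable
    ultimately show ?thesis by (auto simp: \<Phi>_node)
  qed
  ultimately show ?thesis
    using \<Phi>_fe by (intro exI[of _ \<Phi>] exI[of _ \<rho>] conjI allI impI) simp_all
qed

end

section \<open>Existence of an adapted discrete solution\<close>

theorem lemma4p1:
  fixes T \<tau> \<gamma> c\<^sub>\<gamma> \<nu> h :: real and N :: nat
    and D :: "(real^'d) set" and \<T> :: "real \<Rightarrow> (real^'d) set set"
    and F F1 F2 \<sigma> :: "real \<Rightarrow> real"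
    and \<phi>\<^sub>0 :: "real^'d \<Rightarrow> real" and P :: "real \<Rightarrow> (real^'d \<Rightarrow> real) \<Rightarrow> real^'d \<Rightarrow> real"
    and M :: "'w measure" and \<F> :: "real \<Rightarrow> 'w measure"
    and g :: "int \<Rightarrow> real^'d \<Rightarrow> real" and lam :: "int \<Rightarrow> real"
    and \<xi> :: "nat \<Rightarrow> int \<Rightarrow> 'w \<Rightarrow> real" and W :: "nat \<Rightarrow> 'w \<Rightarrow> real^'d \<Rightarrow> real"
    and Z :: "real \<Rightarrow> int set"
  assumes dim: "CARD('d) \<in> {2, 3}"
    and dom: "polyhedral_domain D"
    and prob: "prob_space M"
    and filt: "filtration_upto M T \<F>"
    and grid: "T > 0" "N > 0" "\<tau> = T / real N" "\<tau> < 1"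
    and mesh: "quasi_uniform_family D \<T>"
    and F_C2: "C_k 2 F"
    and F_pos: "\<gamma> > 0" "\<And>z. F z \<ge> \<gamma>"
    and F_growth: "c\<^sub>\<gamma> > 0" "\<And>z. c\<^sub>\<gamma> * (1 + \<bar>z\<bar> ^ 4) \<le> F z"
      "\<exists>C. \<forall>z. F z \<le> C * (1 + \<bar>z\<bar> ^ 4)"
      "\<exists>C. \<forall>z. \<bar>deriv F z\<bar> \<le> C * (1 + \<bar>z\<bar> ^ 3)"
      "\<exists>C. \<forall>z. \<bar>deriv (deriv F) z\<bar> \<le> C * (1 + \<bar>z\<bar> ^ 2)"
    and F_split: "\<And>z. F z = F1 z + F2 z"
    and F1_reg: "\<nu> \<in> {0<..1}" "C_k_Hoelder 2 \<nu> F1"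
    and F2_reg: "C_k 3 F2" "\<exists>C. \<forall>z. \<bar>(deriv ^^ 3) F2 z\<bar> \<le> C * (1 + \<bar>z\<bar> ^ 2)"
    and phi0: "\<phi>\<^sub>0 \<in> H1_space D"
    and P_maps: "\<And>h u. h \<in> {0<..1} \<Longrightarrow> u \<in> H1_space D \<Longrightarrow> P h u \<in> fe_space D (\<T> h)"
      "\<And>h u v. h \<in> {0<..1} \<Longrightarrow> u \<in> H1_space D \<Longrightarrow> v \<in> H1_space D \<Longrightarrow>
         (AE x in lebesgue_on D. u x = v x) \<Longrightarrow> P h u = P h v"
    and P_bound: "\<exists>C. \<forall>h\<in>{0<..1}. H1_norm D (P h \<phi>\<^sub>0) \<le> C"
    and P_conv: "((\<lambda>h. L2_norm D (\<lambda>x. P h \<phi>\<^sub>0 x - \<phi>\<^sub>0 x)) \<longlongrightarrow> 0) (at_right 0)"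
    and sigma: "bounded (range \<sigma>)" "\<exists>L. L-lipschitz_on UNIV \<sigma>"
    and g_basis: "orthonormal_basis_L2 D g"
    and g_reg: "\<And>k. g k \<in> W1inf_space D" "\<And>k. continuous_on (closure D) (g k)"
    and lam_sum: "(\<lambda>k. (lam k)\<^sup>2 * (real_of_ereal (W1inf_norm D (g k)))\<^sup>2) summable_on UNIV"
    and xi: "noise_coefficients M N \<xi>"
    and incr: "noise_increments M \<F> N \<tau> D lam g \<xi> W"
    and Z_fin: "\<And>h. h \<in> {0<..1} \<Longrightarrow> finite (Z h)"
    and h: "h \<in> {0<..1}"
  shows "\<exists>(\<phi> :: nat \<Rightarrow> 'w \<Rightarrow> real^'d \<Rightarrow> real) (r :: nat \<Rightarrow> 'w \<Rightarrow> real).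
    (\<forall>\<omega>\<in>space M. \<phi> 0 \<omega> = P h \<phi>\<^sub>0 \<and> r 0 \<omega> = sqrt (discrete_energy D (\<T> h) F (P h \<phi>\<^sub>0))) \<and>
    (\<forall>n\<in>{1..N}. \<forall>\<omega>\<in>space M. \<phi> n \<omega> \<in> fe_space D (\<T> h) \<and>
       scheme_step D (\<T> h) F \<tau>
         (discrete_noise_op D (\<T> h) \<sigma> g (Z h) (\<phi> (n - 1) \<omega>) (W n \<omega>))
         (\<phi> (n - 1) \<omega>) (r (n - 1) \<omega>) (\<phi> n \<omega>) (r n \<omega>)) \<and>
    (\<forall>n\<in>{1..N}. (\<lambda>\<omega>. (\<phi> n \<omega>, r n \<omega>)) \<in>
       measurable (\<F> (real n * \<tau>)) (L2_borel D (fe_space D (\<T> h)) \<Otimes>\<^sub>M borel))"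
proof -
  have part: "simplicial_partition D (\<T> h)"
    using mesh h by (simp add: quasi_uniform_family_def)
  interpret fe_mesh D "\<T> h"
    by standard (fact dom part)+
  have \<tau>: "\<tau> > 0" using grid by simp
  have grid_time: "real n * \<tau> \<in> {0..T}" if "n \<le> N" for n
  proof -
    have "real n * \<tau> \<le> real N * \<tau>" using that \<tau> by simp
    then show ?thesis using grid \<tau> by simp
  qed

  have diff: "(deriv ^^ j) F field_differentiable at x" if "j < 2" for j x
    using F_C2 that by (simp add: C_k_def)
  have F_cont: "continuous_on UNIV F" "continuous_on UNIV (deriv F)"
    using diff[of 0] diff[of 1]
    by (auto simp: continuous_on_eq_continuous_at intro: field_differentiable_imp_continuous_at)
  have F2_cont: "continuous_on UNIV (deriv (deriv F))"
    using F_C2 by (simp add: C_k_def numeral_2_eq_2)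
  have F_meas: "F \<in> borel_measurable borel" "deriv F \<in> borel_measurable borel"
      "deriv (deriv F) \<in> borel_measurable borel"
    using F_cont F2_cont by (auto intro: borel_measurable_continuous_onI)
  have \<sigma>_meas: "\<sigma> \<in> borel_measurable borel"
    using sigma(2) lipschitz_on_continuous_on by (blast intro: borel_measurable_continuous_onI)

  obtain \<Phi> :: "(real^'d \<Rightarrow> real) \<Rightarrow> (real^'d \<Rightarrow> real) \<Rightarrow> real \<Rightarrow> real^'d \<Rightarrow> real"
    and \<rho> :: "(real^'d \<Rightarrow> real) \<Rightarrow> (real^'d \<Rightarrow> real) \<Rightarrow> real \<Rightarrow> real"
    where step: "\<forall>B u s. \<Phi> B u s \<in> V \<and> scheme_step D (\<T> h) F \<tau> B u s (\<Phi> B u s) (\<rho> B u s)"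
    and step_meas: "\<forall>(A :: 'w measure) B u s.
       (\<forall>q\<in>X. (\<lambda>\<omega>. B \<omega> q) \<in> borel_measurable A) \<longrightarrow>
       (\<forall>q\<in>X. (\<lambda>\<omega>. u \<omega> q) \<in> borel_measurable A) \<longrightarrow> s \<in> borel_measurable A \<longrightarrow>
       (\<forall>p\<in>X. (\<lambda>\<omega>. \<Phi> (B \<omega>) (u \<omega>) (s \<omega>) p) \<in> borel_measurable A) \<and>
       (\<lambda>\<omega>. \<rho> (B \<omega>) (u \<omega>) (s \<omega>)) \<in> borel_measurable A"
    using scheme_step_measurable_solution[OF less_imp_le[OF \<tau>] F_meas, where 'w = 'w] by blast

  define noise where "noise n \<omega> u = discrete_noise_op D (\<T> h) \<sigma> g (Z h) u (W n \<omega>)" for n \<omega> u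
  define sol where "sol \<omega> = rec_nat (P h \<phi>\<^sub>0, sqrt (discrete_energy D (\<T> h) F (P h \<phi>\<^sub>0)))
      (\<lambda>n (u, s). (\<Phi> (noise (Suc n) \<omega> u) u s, \<rho> (noise (Suc n) \<omega> u) u s))" for \<omega>
  have sol_0: "sol \<omega> 0 = (P h \<phi>\<^sub>0, sqrt (discrete_energy D (\<T> h) F (P h \<phi>\<^sub>0)))" for \<omega>
    by (simp add: sol_def)
  have sol_Suc: "sol \<omega> (Suc n)
      = (\<Phi> (noise (Suc n) \<omega> (fst (sol \<omega> n))) (fst (sol \<omega> n)) (snd (sol \<omega> n)),
         \<rho> (noise (Suc n) \<omega> (fst (sol \<omega> n))) (fst (sol \<omega> n)) (snd (sol \<omega> n)))" for \<omega> n
    by (simp add: sol_def split_beta)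

  \<comment> \<open>The noise enters step \<open>n\<close> only through \<open>W n\<close>, which is measurable at time \<open>n \<tau>\<close>, and through the
    previous solution, which is measurable at an earlier time.\<close>
  have adapted: "(\<forall>p\<in>X. (\<lambda>\<omega>. fst (sol \<omega> n) p) \<in> borel_measurable (\<F> (real n * \<tau>)))
      \<and> (\<lambda>\<omega>. snd (sol \<omega> n)) \<in> borel_measurable (\<F> (real n * \<tau>))" if "n \<le> N" for n
    using that
  proof (induction n)
    case 0
    then show ?case by (simp add: sol_0)
  next
    case (Suc n)
    let ?A = "\<F> (real (Suc n) * \<tau>)"
    have times: "real n * \<tau> \<in> {0..T}" "real (Suc n) * \<tau> \<in> {0..T}" "real n * \<tau> \<le> real (Suc n) * \<tau>"
      using grid_time[of n] grid_time[of "Suc n"] Suc.prems \<tau> by auto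
    have sub: "subalgebra ?A (\<F> (real n * \<tau>))"
    proof -
      have "subalgebra M (\<F> (real n * \<tau>))" "subalgebra M ?A"
        using filt times unfolding filtration_upto_def by blast+
      moreover have "sets (\<F> (real n * \<tau>)) \<subseteq> sets ?A"
        using filt times unfolding filtration_upto_def by blast
      ultimately show ?thesis by (simp add: subalgebra_def)
    qed
    have u: "(\<lambda>\<omega>. fst (sol \<omega> n) q) \<in> borel_measurable ?A" if "q \<in> X" for q
      using Suc that by (intro measurable_from_subalg[OF sub]) simp
    have s: "(\<lambda>\<omega>. snd (sol \<omega> n)) \<in> borel_measurable ?A"
      using Suc by (intro measurable_from_subalg[OF sub]) simp
    have "discrete_filtration \<tau> \<F> (real (Suc n) * \<tau>) = ?A"
      using \<tau> by (simp add: discrete_filtration_def del: of_nat_Suc)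
    then have W: "W (Suc n) \<in> measurable ?A (L2_borel D (L2_space D))"
      using incr Suc.prems unfolding noise_increments_def by (metis atLeastAtMost_iff le_add1 plus_1_eq_Suc)
    have noise_node: "noise (Suc n) \<omega> v q
        = (\<Sum>k\<in>Z h. \<sigma> (v q) * L2_inner D (W (Suc n) \<omega>) (g k) * g k q)" if "q \<in> X" for \<omega> v q
      using that by (simp add: noise_def discrete_noise_op_def nodal_interp(2))
    have B: "(\<lambda>\<omega>. noise (Suc n) \<omega> (fst (sol \<omega> n)) q) \<in> borel_measurable ?A" if q: "q \<in> X" for q
    proof -
      have "(\<lambda>\<omega>. L2_inner D (W (Suc n) \<omega>) (g k)) \<in> borel_measurable ?A" for k
        using measurable_compose[OF W L2_inner_measurable, of "g k"] g_basis
        by (simp add: orthonormal_basis_L2_def)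
      moreover have "(\<lambda>\<omega>. \<sigma> (fst (sol \<omega> n) q)) \<in> borel_measurable ?A"
        by (rule measurable_compose[OF u[OF q] \<sigma>_meas])
      ultimately show ?thesis
        unfolding noise_node[OF q] by (intro borel_measurable_sum borel_measurable_times) auto
    qed
    show ?case
      unfolding sol_Suc fst_conv snd_conv
      by (rule step_meas[rule_format (no_asm)]) (use B u s in auto)
  qed

  show ?thesis
  proof (intro exI[of _ "\<lambda>n \<omega>. fst (sol \<omega> n)"] exI[of _ "\<lambda>n \<omega>. snd (sol \<omega> n)"] conjI ballI)
    fix \<omega>
    show "fst (sol \<omega> 0) = P h \<phi>\<^sub>0" "snd (sol \<omega> 0) = sqrt (discrete_energy D (\<T> h) F (P h \<phi>\<^sub>0))"
      by (simp_all add: sol_0)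
  next
    fix n \<omega> assume "n \<in> {1..N}"
    then obtain m where n: "n = Suc m" by (cases n) auto
    show "fst (sol \<omega> n) \<in> V"
      using step by (simp add: n sol_Suc)
    show "scheme_step D (\<T> h) F \<tau>
         (discrete_noise_op D (\<T> h) \<sigma> g (Z h) (fst (sol \<omega> (n - 1))) (W n \<omega>))
         (fst (sol \<omega> (n - 1))) (snd (sol \<omega> (n - 1))) (fst (sol \<omega> n)) (snd (sol \<omega> n))"
      using step by (simp add: n sol_Suc noise_def)
  next
    fix n assume n: "n \<in> {1..N}"
    then obtain m where m: "n = Suc m" by (cases n) auto
    have "fst (sol \<omega> n) = (\<lambda>x. \<Sum>p\<in>X. fst (sol \<omega> n) p * hat p x)" for \<omega>
      using step by (intro fe_expansion) (simp add: m sol_Suc)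
    moreover have "(\<lambda>\<omega> x. \<Sum>p\<in>X. fst (sol \<omega> n) p * hat p x) \<in> measurable (\<F> (real n * \<tau>)) (L2_borel D V)"
      using adapted[of n] n by (intro measurable_into_L2_borel) auto
    ultimately have "(\<lambda>\<omega>. fst (sol \<omega> n)) \<in> measurable (\<F> (real n * \<tau>)) (L2_borel D V)"
      by simp
    then show "(\<lambda>\<omega>. (fst (sol \<omega> n), snd (sol \<omega> n)))
        \<in> measurable (\<F> (real n * \<tau>)) (L2_borel D V \<Otimes>\<^sub>M borel)"
      using adapted[of n] n by (intro measurable_Pair) auto
  qed
qed
end
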